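(* Let $E$ be a separable reflexive Banach space, $f:\Omega\times E\to\overline{\mathbb{R}}$ a $\mathbb{T}\otimes\mathcal{B}(E)$-measurable integrand, and $x_0\in L_1(\Omega,E)$ with $f(x_0)$ integrable. (1) If the integral functional $I_f$ is weakly Hadamard subdifferentiable at $x_0$ on $L_1(\Omega,E)$ (i.e. $\partial^\sigma I_f(x_0)\neq\emptyset$), then the integrand $f$ has the $\sigma$-differential lower compactness property at $x_0$. (2) If the integrand $f$ has the $\sigma$-differential lower compactness property at $x_0$, then $$L_\infty(\partial^\sigma f(x_0))\subseteq\partial^\sigma I_f(x_0).$$
   Context: $(\Omega,\mathbb{T},\mu)$ is a measure space with $\mu$ a $\sigma$-finite positive measure and $\mathbb{T}$ $\mu$-complete. $I_f(x)=\int^*_\Omega f(\omega,x(\omega))\,d\mu(\omega)$ with $\int^*_\Omega v\,d\mu=\inf\{\int_\Omega u\,d\mu: u\in L_1(\Omega,\mathbb{R}),\ u\ge v\text{ a.e.}\}$; $f(x)$ is the function $\omega\mapsto f(\omega,x(\omega))$ and $f_\omega=f(\omega,\cdot)$. $\sigma$ denotes the weak topology (of $E$, respectively of $L_1(\Omega,E)$); since $E$ is reflexive, $L_1(\Omega,E)^*=L_\infty(\Omega,E^* )$. For a function $J$ on a Banach space $Y$, finite at $y_0$, put $[J](y_0,y,r)=r^{-1}(J(y_0+ry)-J(y_0))$ and $$J^\sigma(y_0;y)=\inf\{\liminf_n[J](y_0,y_n,r_n): y_n\to y\text{ weakly},\ r_n>0,\ r_n\to0\}.$$ The weak Hadamard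 subdifferential is $\partial^\sigma J(y_0)=\{y^*\in Y^*: \langle y^*,y\rangle\le J^\sigma(y_0;y)\ \forall y\in Y\}$. $L_\infty(\partial^\sigma f(x_0))$ is the set of $x^*\in L_\infty(\Omega,E^* )$ such that $x^*(\omega)\in\partial^\sigma f_\omega(x_0(\omega))$ for almost every $\omega$. A subset $X$ of $L_1(\Omega,\mathbb{R})$ is uniformly integrable if it is bounded in $L_1$ and for every $\epsilon>0$ there are $\eta>0$ and a measurable $K$ of finite measure with $\sup_{u\in X}\|u1_A\|_1<\epsilon$ whenever $\mu(A)\le\eta$, and $\sup_{u\in X}\|u1_{K^c}\|_1<\epsilon$. $f$ has the $\sigma$-differential lower compactness property at $x_0$ if for every sequence $(r_n)_n$ of positive numbers converging to $0$ and every sequence $(x_n)_n$ contained in a relatively sequentially weakly compact subset of $L_1(\Omega,E)$, the negative parts of the functions $\omega\mapsto r_n^{-1}(f(\omega,x_0(\omega)+r_nx_n(\omega))-f(\omega,x_0(\omega)))$ form, for $n\ge n_0$ with some $n_0$, a uniformly integrable family in $L_1(\Omega,\mathbb{R})$. *)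

theory Defs
  imports "HOL-Analysis.Analysis"
begin

section \<open>Normed spaces with an explicit carrier\<close>

text \<open>
  The weak Hadamard subdifferential is needed both on the space \<open>E\<close> (a type) and on
  \<open>L\<^sub>1(\<Omega>, E)\<close>, which depends on a measure and hence is not a type. It is therefore defined over a
  carrier with explicit operations. The space \<open>L\<^sub>1(\<Omega>, E)\<close> is represented by integrable functions
  instead of equivalence classes, so \<open>nrm\<close> is only a seminorm there. Bounded functionals do not
  distinguish functions that agree almost everywhere, and neither does \<open>integral_functional\<close>.
\<close>

record 'y nspace =
  pts :: "'y set"
  add :: "'y \<Rightarrow> 'y \<Rightarrow> 'y"
  scl :: "real \<Rightarrow> 'y \<Rightarrow> 'y"
  nrm :: "'y \<Rightarrow> real"

definition type_space :: "'e::real_normed_vector nspace" where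
  "type_space = \<lparr>pts = UNIV, add = (+), scl = (*\<^sub>R), nrm = norm\<rparr>"

definition L1_norm :: "'w measure \<Rightarrow> ('w \<Rightarrow> 'e::real_normed_vector) \<Rightarrow> real" where
  "L1_norm M x = (LINT \<omega>|M. norm (x \<omega>))"

definition L1_space :: "'w measure \<Rightarrow> ('w \<Rightarrow> 'e::{banach, second_countable_topology}) nspace" where
  "L1_space M = \<lparr>pts = {x. integrable M x},
     add = (\<lambda>x y \<omega>. x \<omega> + y \<omega>), scl = (\<lambda>c x \<omega>. c *\<^sub>R x \<omega>), nrm = L1_norm M\<rparr>"

definition dual :: "'y nspace \<Rightarrow> ('y \<Rightarrow> real) set" where
  "dual Y = {\<phi>. (\<forall>x\<in>pts Y. \<forall>y\<in>pts Y. \<phi> (add Y x y) = \<phi> x + \<phi> y) \<and>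
                (\<forall>c. \<forall>x\<in>pts Y. \<phi> (scl Y c x) = c * \<phi> x) \<and>
                (\<exists>C. \<forall>x\<in>pts Y. \<bar>\<phi> x\<bar> \<le> C * nrm Y x)}"

lemma dual_type_space: "dual type_space = {\<phi>. bounded_linear \<phi>}"
  by (auto simp: dual_def type_space_def bounded_linear_def bounded_linear_axioms_def
      linear_iff mult.commute)

definition weakly_tendsto :: "'y nspace \<Rightarrow> (nat \<Rightarrow> 'y) \<Rightarrow> 'y \<Rightarrow> bool" where
  "weakly_tendsto Y y l \<longleftrightarrow>
     range y \<subseteq> pts Y \<and> l \<in> pts Y \<and> (\<forall>\<phi>\<in>dual Y. (\<lambda>n. \<phi> (y n)) \<longlonglongrightarrow> \<phi> l)"

definition rel_seq_weakly_compact :: "'y nspace \<Rightarrow> 'y set \<Rightarrow> bool" where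
  "rel_seq_weakly_compact Y S \<longleftrightarrow> S \<subseteq> pts Y \<and>
     (\<forall>y :: nat \<Rightarrow> 'y. range y \<subseteq> S \<longrightarrow>
        (\<exists>l. \<exists>s :: nat \<Rightarrow> nat. strict_mono s \<and> weakly_tendsto Y (y \<circ> s) l))"

definition reflexive_space :: "'e::real_normed_vector itself \<Rightarrow> bool" where
  "reflexive_space _ \<longleftrightarrow>
     (\<forall>\<Phi> :: ('e \<Rightarrow>\<^sub>L real) \<Rightarrow>\<^sub>L real. \<exists>x. \<forall>\<phi>. blinfun_apply \<Phi> \<phi> = blinfun_apply \<phi> x)"

section \<open>The weak Hadamard subdifferential\<close>

definition diff_quot :: "'y nspace \<Rightarrow> ('y \<Rightarrow> ereal) \<Rightarrow> 'y \<Rightarrow> 'y \<Rightarrow> real \<Rightarrow> ereal" where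
  "diff_quot Y J y0 y r = ereal (inverse r) * (J (add Y y0 (scl Y r y)) - J y0)"

definition weak_lower_deriv :: "'y nspace \<Rightarrow> ('y \<Rightarrow> ereal) \<Rightarrow> 'y \<Rightarrow> 'y \<Rightarrow> ereal" where
  "weak_lower_deriv Y J y0 y =
     Inf {liminf (\<lambda>n. diff_quot Y J y0 (yn n) (rn n)) | yn rn.
            weakly_tendsto Y yn y \<and> (\<forall>n. rn n > 0) \<and> rn \<longlonglongrightarrow> 0}"

definition weak_subdiff :: "'y nspace \<Rightarrow> ('y \<Rightarrow> ereal) \<Rightarrow> 'y \<Rightarrow> ('y \<Rightarrow> real) set" where
  "weak_subdiff Y J y0 =
     {\<phi> \<in> dual Y. \<forall>y\<in>pts Y. ereal (\<phi> y) \<le> weak_lower_deriv Y J y0 y}"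

section \<open>Integral functionals\<close>

definition upper_integral :: "'w measure \<Rightarrow> ('w \<Rightarrow> ereal) \<Rightarrow> ereal" where
  "upper_integral M v =
     (INF u\<in>{u :: 'w \<Rightarrow> real. integrable M u \<and> (AE \<omega> in M. v \<omega> \<le> ereal (u \<omega>))}.
        ereal (LINT \<omega>|M. u \<omega>))"

definition integral_functional ::
    "'w measure \<Rightarrow> ('w \<Rightarrow> 'e \<Rightarrow> ereal) \<Rightarrow> ('w \<Rightarrow> 'e) \<Rightarrow> ereal" where
  "integral_functional M f x = upper_integral M (\<lambda>\<omega>. f \<omega> (x \<omega>))"

text \<open>An extended real function represents an element of \<open>L\<^sub>1(\<Omega>, \<real>)\<close>; it is then finite
  almost everywhere.\<close>

definition integrable_ereal :: "'w measure \<Rightarrow> ('w \<Rightarrow> ereal) \<Rightarrow> bool" where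
  "integrable_ereal M v \<longleftrightarrow>
     (\<exists>u :: 'w \<Rightarrow> real. integrable M u \<and> (AE \<omega> in M. v \<omega> = ereal (u \<omega>)))"

text \<open>The suprema are taken in \<open>ereal\<close> so that they are meaningful for every family.\<close>

definition uniformly_integrable :: "'w measure \<Rightarrow> ('w \<Rightarrow> real) set \<Rightarrow> bool" where
  "uniformly_integrable M X \<longleftrightarrow>
     (\<forall>u\<in>X. integrable M u) \<and>
     (\<exists>C. \<forall>u\<in>X. L1_norm M u \<le> C) \<and>
     (\<forall>\<epsilon>>0. \<exists>\<eta>>0. \<exists>K\<in>sets M. emeasure M K < \<infinity> \<and>
        (\<forall>A\<in>sets M. emeasure M A \<le> ennreal \<eta> \<longrightarrow>
           (SUP u\<in>X. ereal (L1_norm M (\<lambda>\<omega>. u \<omega> * indicator A \<omega>))) < ereal \<epsilon>) \<and>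
        (SUP u\<in>X. ereal (L1_norm M (\<lambda>\<omega>. u \<omega> * indicator (space M - K) \<omega>))) < ereal \<epsilon>)"

text \<open>The negative parts are extended real valued; \<open>u n\<close> are real representatives of them.\<close>

definition weak_diff_lower_compact ::
    "'w measure \<Rightarrow> ('w \<Rightarrow> 'e::{banach, second_countable_topology} \<Rightarrow> ereal) \<Rightarrow> ('w \<Rightarrow> 'e) \<Rightarrow> bool"
  where
  "weak_diff_lower_compact M f x0 \<longleftrightarrow>
     (\<forall>r x S. (\<forall>n. r n > 0) \<longrightarrow> r \<longlonglongrightarrow> 0 \<longrightarrow>
        rel_seq_weakly_compact (L1_space M) S \<longrightarrow> range x \<subseteq> S \<longrightarrow>
        (\<exists>n0 :: nat. \<exists>u :: nat \<Rightarrow> 'w \<Rightarrow> real.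
           (\<forall>n\<ge>n0. AE \<omega> in M.
              max 0 (- diff_quot type_space (f \<omega>) (x0 \<omega>) (x n \<omega>) (r n)) = ereal (u n \<omega>)) \<and>
           uniformly_integrable M (u ` {n0..})))"

text \<open>
  The set \<open>L\<^sub>\<infinity>(\<Gamma>)\<close> of essentially bounded measurable selections of a multifunction \<open>\<Gamma>\<close> into the dual.
  If \<open>E\<close> is separable and reflexive, its dual is separable, so Borel measurability is strong
  measurability.
\<close>

definition Linf_selections ::
    "'w measure \<Rightarrow> ('w \<Rightarrow> ('e::real_normed_vector \<Rightarrow> real) set) \<Rightarrow> ('w \<Rightarrow> 'e \<Rightarrow>\<^sub>L real) set" where
  "Linf_selections M \<Gamma> =
     {xs. xs \<in> borel_measurable M \<and> (\<exists>C. AE \<omega> in M. norm (xs \<omega>) \<le> C) \<and>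
          (AE \<omega> in M. blinfun_apply (xs \<omega>) \<in> \<Gamma> \<omega>)}"

text \<open>The functional on \<open>L\<^sub>1(\<Omega>, E)\<close> given by an element of \<open>L\<^sub>\<infinity>(\<Omega>, E\<^sup>*)\<close>.\<close>

definition Linf_pairing ::
    "'w measure \<Rightarrow> ('w \<Rightarrow> 'e::real_normed_vector \<Rightarrow>\<^sub>L real) \<Rightarrow> ('w \<Rightarrow> 'e) \<Rightarrow> real" where
  "Linf_pairing M xs x = (LINT \<omega>|M. blinfun_apply (xs \<omega>) (x \<omega>))"

end

theory Submission
  imports Defs
begin

text \<open>
  For the first part, suppose a functional \<open>\<phi>\<close> is a weak Hadamard subgradient of the integral functional
  \<open>I\<close> at \<open>x0\<close> and let \<open>q n\<close> be the pointwise difference quotients along \<open>r n\<close> and \<open>x n\<close>. The integral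
  functional may be tested with any restriction of \<open>x n\<close> to a measurable set \<open>B n\<close>: if \<open>B n\<close> is contained in
  \<open>{q n < 0}\<close>, its difference quotient at the restricted direction is at most minus the integral over \<open>B n\<close> of
  the negative part of \<open>q n\<close> (\<open>functional_quot_cut_le\<close>). If the restricted directions converge weakly to zero,
  these integrals can therefore not stay away from zero. There are two ways to produce such directions.
  If the negative parts were not bounded in \<open>L\<^sub>1\<close>, one shrinks the direction and enlarges the step by the
  same factor; the quotient shrinks only by that factor, while the directions tend to zero in norm
  because weakly convergent sequences are bounded (\<open>negative_parts_bounded\<close>). If they were bounded but not
  uniformly integrable, one restricts to sets \<open>A n\<close> that almost every point eventually leaves. Restricting a
  weakly convergent sequence to such sets gives a weakly null sequence
  (\<open>weakly_tendsto_cut_escaping\<close>), a Vitali-Hahn-Saks theorem proved by a gliding hump.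
  
  For the second part, let \<open>xs\<close> be a bounded measurable selection of the subdifferentials, let \<open>y n\<close> converge weakly
  to \<open>l\<close>, and let \<open>h n\<close> be the positive part of \<open>xs(y n) - q n\<close>. The difference quotient of \<open>I\<close> is at least
  the pairing of \<open>xs\<close> with \<open>y n\<close> minus the integral of \<open>h n\<close>, so it is enough that the latter tends to zero along a
  subsequence of a sequence realising the lower limit. In a separable reflexive space a bounded sequence has a weakly
  convergent subsequence, hence at almost every point \<open>h n\<close> becomes small along those \<open>n\<close> for which the norm of \<open>y n\<close>
  stays below a given radius (\<open>weak_subdiff_bounded_lower_bound\<close>). As \<open>y n\<close> is bounded in \<open>L\<^sub>1\<close>, large norms occur on small
  sets only, and a subsequence of \<open>h n\<close> converges to zero almost everywhere (\<open>deficit_AE_null_subseq\<close>). Finally \<open>h n\<close> is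
  dominated by the pairing plus the negative part of \<open>q n\<close>. The first is uniformly integrable by the
  Vitali-Hahn-Saks theorem again, the second by the lower compactness property, and Vitali's theorem
  gives convergence of the integrals.
  
  The linear functionals behind weak convergence come from the Hahn-Banach theorem. It gives
  the countable norming family on \<open>E\<close>, the density of its span in the dual space, and the norming functionals
  on \<open>L\<^sub>1\<close> that make weakly convergent sequences bounded.
\<close>

section \<open>The Hahn-Banach theorem\<close>

text \<open>
  The inequality for all \<open>c > 0\<close> amounts to positive homogeneity, as one sees by applying it to \<open>1 / c\<close>. It is
  easier to verify for infima.
\<close>

definition sublinear :: "('a::real_vector \<Rightarrow> real) \<Rightarrow> bool" where
  "sublinear p \<longleftrightarrow> (\<forall>x y. p (x + y) \<le> p x + p y) \<and> (\<forall>c>0. \<forall>x. p (c *\<^sub>R x) \<le> c * p x)"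

lemma sublinear_zero: "sublinear p \<Longrightarrow> p 0 = 0"
proof -
  assume p: "sublinear p"
  have "p (0 + 0) \<le> p 0 + p 0" "p ((1/2) *\<^sub>R 0) \<le> (1/2) * p 0"
    using p unfolding sublinear_def by (blast, meson half_gt_zero_iff zero_less_one)
  then show ?thesis by simp
qed

lemma sublinear_scale:
  assumes p: "sublinear p" and c: "0 \<le> c" shows "p (c *\<^sub>R x) = c * p x"
proof (cases "c = 0")
  case True then show ?thesis using sublinear_zero[OF p] by simp
next
  case False
  with c have c: "c > 0" by simp
  have "p (inverse c *\<^sub>R (c *\<^sub>R x)) \<le> inverse c * p (c *\<^sub>R x)"
    using p c unfolding sublinear_def by (meson positive_imp_inverse_positive)
  then have "c * p x \<le> p (c *\<^sub>R x)" using c by (simp add: field_simps)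
  moreover have "p (c *\<^sub>R x) \<le> c * p x" using p c unfolding sublinear_def by blast
  ultimately show ?thesis by simp
qed

lemma sublinear_lower: "sublinear p \<Longrightarrow> - p (- x) \<le> p x"
  using sublinear_zero[of p] unfolding sublinear_def
  by (metis add.right_inverse neg_le_iff_le minus_le_iff le_add_same_cancel1 add.commute diff_0 diff_le_eq)

text \<open>
  The witness is the infimum over \<open>t \<ge> 0\<close> of \<open>q (x + t a) - t q a\<close>. It forces a minimal sublinear
  functional to be odd, and an odd sublinear functional is linear. Extending functionals from
  subspaces step by step is thereby avoided.
\<close>

lemma sublinear_tilt:
  assumes q: "sublinear q"
  shows "\<exists>q'. sublinear q' \<and> (\<forall>x. q' x \<le> q x) \<and> q' (- a) \<le> - q a"
proof -
  define g where "g x t = q (x + t *\<^sub>R a) - t * q a" for x t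
  define q' where "q' x = (INF t\<in>{0..}. g x t)" for x
  have sub: "q (x + y) \<le> q x + q y" for x y using q by (simp add: sublinear_def)
  have low: "- q (- x) \<le> g x t" if "t \<ge> 0" for x t
  proof -
    have "q (t *\<^sub>R a) \<le> q (x + t *\<^sub>R a) + q (- x)"
      using sub[of "x + t *\<^sub>R a" "- x"] by simp
    then show ?thesis using sublinear_scale[OF q that] by (simp add: g_def)
  qed
  have bdd: "bdd_below (g x ` {0..})" for x
    using low by (auto intro!: bdd_belowI[of _ "- q (- x)"])
  have le: "q' x \<le> g x t" if "t \<ge> 0" for x t
    unfolding q'_def using that by (intro cINF_lower bdd) auto
  have great: "m \<le> q' x" if "\<And>t. t \<ge> 0 \<Longrightarrow> m \<le> g x t" for m x
    unfolding q'_def using that by (intro cINF_greatest) auto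
  have "q' (x + y) \<le> q' x + q' y" for x y
  proof -
    have *: "q' (x + y) \<le> g x t + g y s" if "t \<ge> 0" "s \<ge> 0" for t s
    proof -
      have "q' (x + y) \<le> g (x + y) (t + s)" using that by (intro le) simp
      also have "\<dots> \<le> g x t + g y s"
        using sub[of "x + t *\<^sub>R a" "y + s *\<^sub>R a"] by (simp add: g_def algebra_simps)
      finally show ?thesis .
    qed
    have "q' (x + y) - g y s \<le> q' x" if "s \<ge> 0" for s
      using * that by (intro great) (simp add: diff_le_eq)
    then have "q' (x + y) - q' x \<le> q' y" by (intro great) (simp add: diff_le_eq add.commute)
    then show ?thesis by simp
  qed
  moreover have "q' (c *\<^sub>R x) \<le> c * q' x" if c: "c > 0" for c x
  proof -
    have "q' (c *\<^sub>R x) / c \<le> q' x"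
    proof (rule great)
      fix t :: real assume t: "t \<ge> 0"
      have "q' (c *\<^sub>R x) \<le> g (c *\<^sub>R x) (c * t)" using t c by (intro le) simp
      also have "\<dots> = c * g x t"
        using sublinear_scale[OF q, of c "x + t *\<^sub>R a"] c by (simp add: g_def algebra_simps)
      finally show "q' (c *\<^sub>R x) / c \<le> g x t" using c by (simp add: field_simps)
    qed
    then show ?thesis using c by (simp add: field_simps)
  qed
  ultimately have "sublinear q'" by (simp add: sublinear_def)
  moreover have "q' x \<le> q x" for x using le[of 0 x] by (simp add: g_def)
  moreover have "q' (- a) \<le> - q a"
    using le[of 1 "- a"] sublinear_zero[OF q] by (simp add: g_def)
  ultimately show ?thesis by blast
qed

lemma sublinear_odd_imp_linear:
  assumes q: "sublinear q" and odd: "\<And>a. q (- a) \<le> - q a"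
  shows "linear q"
proof
  have m: "q (- a) = - q a" for a using odd[of a] sublinear_lower[OF q, of a] by simp
  fix x y
  have "q (- x + - y) \<le> q (- x) + q (- y)" "q (x + y) \<le> q x + q y"
    using q unfolding sublinear_def by blast+
  then show "q (x + y) = q x + q y" using m[of x] m[of y] m[of "x + y"] by simp
  fix c :: real
  show "q (c *\<^sub>R x) = c *\<^sub>R q x"
  proof (cases "c \<ge> 0")
    case True then show ?thesis using sublinear_scale[OF q] by simp
  next
    case False
    then have "q ((- c) *\<^sub>R x) = (- c) * q x" by (intro sublinear_scale q) simp
    then show ?thesis using m[of "c *\<^sub>R x"] by simp
  qed
qed

text \<open>
  Zorn's lemma applies since the pointwise infimum of a chain is again sublinear: for two members
  \<open>q\<close> and \<open>q'\<close> of the chain, the smaller one bounds the value at \<open>x + y\<close> by \<open>q x + q' y\<close>.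
\<close>

lemma minimal_sublinear:
  assumes p: "sublinear p"
  obtains q where "sublinear q" "\<And>x. q x \<le> p x"
    "\<And>q'. sublinear q' \<Longrightarrow> (\<And>x. q' x \<le> q x) \<Longrightarrow> q' = q"
proof -
  define A where "A = {q. sublinear q \<and> (\<forall>x. q x \<le> p x)}"
  define P where "P = (\<lambda>q q' :: 'a \<Rightarrow> real. \<forall>x. q' x \<le> q x)"
  have "\<exists>m\<in>A. \<forall>a\<in>A. P m a \<longrightarrow> a = m"
  proof (rule predicate_Zorn)
    show "partial_order_on A (relation_of P A)"
      by (auto intro!: partial_order_on_relation_ofI simp: P_def intro: order_trans)
        (meson antisym ext)+
    fix C assume C: "C \<in> Chains (relation_of P A)"
    have CA: "C \<subseteq> A" using C by (auto simp: Chains_def relation_of_def)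
    have tot: "P q q' \<or> P q' q" if "q \<in> C" "q' \<in> C" for q q'
      using C that by (auto simp: Chains_def relation_of_def)
    show "\<exists>u\<in>A. \<forall>a\<in>C. P a u"
    proof (cases "C = {}")
      case True then show ?thesis using p by (auto simp: A_def)
    next
      case ne: False
      define u where "u x = (INF q\<in>C. q x)" for x
      have bdd: "bdd_below ((\<lambda>q. q x) ` C)" for x
      proof (rule bdd_belowI2)
        fix q assume "q \<in> C"
        then have "sublinear q" "q (- x) \<le> p (- x)" using CA by (auto simp: A_def)
        then show "- p (- x) \<le> q x" using sublinear_lower[of q x] by simp
      qed
      have le: "u x \<le> q x" if "q \<in> C" for q x
        unfolding u_def using that by (intro cINF_lower bdd)
      have great: "m \<le> u x" if "\<And>q. q \<in> C \<Longrightarrow> m \<le> q x" for m x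
        unfolding u_def using that ne by (intro cINF_greatest)
      have "u (x + y) \<le> u x + u y" for x y
      proof -
        have *: "u (x + y) \<le> q x + q' y" if qs: "q \<in> C" "q' \<in> C" for q q'
        proof -
          obtain s where s: "s \<in> C" "s x \<le> q x" "s y \<le> q' y"
            using tot[OF qs] qs unfolding P_def by blast
          have "s (x + y) \<le> s x + s y" using s(1) CA by (auto simp: A_def sublinear_def)
          then show ?thesis using le[OF s(1), of "x + y"] s by linarith
        qed
        have "u (x + y) - q' y \<le> u x" if "q' \<in> C" for q'
          using * that by (intro great) (simp add: diff_le_eq)
        then have "u (x + y) - u x \<le> u y" by (intro great) (simp add: diff_le_eq add.commute)
        then show ?thesis by simp
      qed
      moreover have "u (c *\<^sub>R x) \<le> c * u x" if c: "c > 0" for c x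
      proof -
        have "u (c *\<^sub>R x) / c \<le> u x"
        proof (rule great)
          fix q assume "q \<in> C"
          then have "u (c *\<^sub>R x) \<le> q (c *\<^sub>R x)" "q (c *\<^sub>R x) \<le> c * q x"
            using le CA c by (auto simp: A_def sublinear_def)
          then show "u (c *\<^sub>R x) / c \<le> q x" using c by (simp add: field_simps)
        qed
        then show ?thesis using c by (simp add: field_simps)
      qed
      moreover have "u x \<le> p x" for x
        using ne le CA unfolding A_def by (metis (mono_tags, lifting) all_not_in_conv mem_Collect_eq order_trans subsetD)
      ultimately have "u \<in> A" by (simp add: A_def sublinear_def)
      then show ?thesis using le by (auto simp: P_def)
    qed
  qed
  then obtain q where q: "q \<in> A" and mn: "\<And>q'. q' \<in> A \<Longrightarrow> P q q' \<Longrightarrow> q' = q" by blast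
  show ?thesis
  proof (rule that[of q])
    fix q' assume "sublinear q'" "\<And>x. q' x \<le> q x"
    then show "q' = q" using q by (intro mn) (auto simp: A_def P_def intro: order_trans)
  qed (use q in \<open>auto simp: A_def\<close>)
qed

text \<open>
  Tilting \<open>p\<close> at \<open>a\<close> before passing to a minimal functional gives equality at \<open>a\<close>. By minimality every
  further tilt leaves the functional unchanged, which makes it odd.
\<close>

lemma hahn_banach_sublinear:
  assumes p: "sublinear p"
  obtains q where "linear q" "\<And>x. q x \<le> p x" "q a = p a"
proof -
  obtain p' where p': "sublinear p'" "\<And>x. p' x \<le> p x" "p' (- a) \<le> - p a"
    using sublinear_tilt[OF p] by blast
  obtain q where q: "sublinear q" "\<And>x. q x \<le> p' x"
    and mn: "\<And>q'. sublinear q' \<Longrightarrow> (\<And>x. q' x \<le> q x) \<Longrightarrow> q' = q"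
    using minimal_sublinear[OF p'(1)] by blast
  have "q (- b) \<le> - q b" for b
    using sublinear_tilt[OF q(1), of b] mn by blast
  then have lin: "linear q" by (rule sublinear_odd_imp_linear[OF q(1)])
  have le: "q x \<le> p x" for x using q(2) p'(2) order_trans by blast
  have "q (- a) \<le> - p a" using q(2) p'(3) order_trans by blast
  then have "q a = p a" using le[of a] linear_neg[OF lin, of a] by simp
  then show ?thesis using that lin le by blast
qed

lemma linear_le_norm_imp_blinfun:
  fixes q :: "'a::real_normed_vector \<Rightarrow> real"
  assumes q: "linear q" and le: "\<And>x. q x \<le> norm x"
  obtains \<phi> :: "'a \<Rightarrow>\<^sub>L real" where "\<And>x. blinfun_apply \<phi> x = q x" "norm \<phi> \<le> 1"
proof -
  have ab: "\<bar>q x\<bar> \<le> norm x" for x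
    using le[of x] le[of "- x"] linear_neg[OF q, of x] by (simp add: abs_le_iff)
  have bl: "bounded_linear q"
    using q ab by (intro bounded_linear_intro[of _ 1]) (auto simp: linear_add linear_scale)
  show ?thesis
  proof (rule that[of "Blinfun q"])
    show ap: "blinfun_apply (Blinfun q) x = q x" for x by (simp add: bounded_linear_Blinfun_apply[OF bl])
    show "norm (Blinfun q) \<le> 1" by (rule norm_blinfun_bound) (simp_all add: ap ab)
  qed
qed

lemma norming_functional:
  fixes a :: "'a::real_normed_vector"
  obtains \<phi> :: "'a \<Rightarrow>\<^sub>L real" where "norm \<phi> \<le> 1" "blinfun_apply \<phi> a = norm a"
proof -
  have "sublinear (norm :: 'a \<Rightarrow> real)" by (simp add: sublinear_def norm_triangle_ineq)
  then obtain q where q: "linear q" "\<And>x. q x \<le> norm x" "q a = norm a"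
    using hahn_banach_sublinear by blast
  then show ?thesis using linear_le_norm_imp_blinfun[OF q(1,2)] that by metis
qed

text \<open>
  The distance to \<open>V\<close> is sublinear, at most the norm, zero on \<open>V\<close> and positive at \<open>a\<close>.
\<close>

lemma functional_vanishing_on_subspace:
  fixes V :: "'a::real_normed_vector set"
  assumes V: "subspace V" and a: "a \<notin> closure V"
  obtains \<phi> :: "'a \<Rightarrow>\<^sub>L real" where "\<And>v. v \<in> V \<Longrightarrow> blinfun_apply \<phi> v = 0" "blinfun_apply \<phi> a \<noteq> 0"
proof -
  have ne: "V \<noteq> {}" using subspace_0[OF V] by blast
  define p where "p x = infdist x V" for x
  have le: "p x \<le> norm (x - v)" if "v \<in> V" for x v
    using infdist_le[OF that] by (simp add: p_def dist_norm)
  have great: "m \<le> p x" if "\<And>v. v \<in> V \<Longrightarrow> m \<le> norm (x - v)" for m x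
    unfolding p_def infdist_def using ne that by (auto simp: dist_norm intro!: cINF_greatest)
  have "p (x + y) \<le> p x + p y" for x y
  proof -
    have *: "p (x + y) \<le> norm (x - v) + norm (y - w)" if "v \<in> V" "w \<in> V" for v w
      using le[OF subspace_add[OF V that], of "x + y"] norm_triangle_ineq[of "x - v" "y - w"]
      by (simp add: algebra_simps)
    have "p (x + y) - norm (y - w) \<le> p x" if "w \<in> V" for w
      using * that by (intro great) (simp add: diff_le_eq)
    then have "p (x + y) - p x \<le> p y" by (intro great) (simp add: diff_le_eq add.commute)
    then show ?thesis by simp
  qed
  moreover have "p (c *\<^sub>R x) \<le> c * p x" if c: "c > 0" for c x
  proof -
    have "p (c *\<^sub>R x) / c \<le> p x"
    proof (rule great)
      fix v assume "v \<in> V"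
      then have "p (c *\<^sub>R x) \<le> norm (c *\<^sub>R x - c *\<^sub>R v)" by (intro le subspace_scale V)
      also have "\<dots> = c * norm (x - v)" using c by (simp flip: scaleR_diff_right)
      finally show "p (c *\<^sub>R x) / c \<le> norm (x - v)" using c by (simp add: field_simps)
    qed
    then show ?thesis using c by (simp add: field_simps)
  qed
  ultimately have "sublinear p" by (simp add: sublinear_def)
  then obtain q where q: "linear q" "\<And>x. q x \<le> p x" "q a = p a"
    using hahn_banach_sublinear by blast
  have "p x \<le> norm x" for x using le[OF subspace_0[OF V], of x] by simp
  then have "q x \<le> norm x" for x using q(2) order_trans by blast
  then obtain \<phi> :: "'a \<Rightarrow>\<^sub>L real" where \<phi>: "\<And>x. blinfun_apply \<phi> x = q x"
    using linear_le_norm_imp_blinfun[OF q(1)] by metis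
  show ?thesis
  proof (rule that[of \<phi>])
    fix v assume v: "v \<in> V"
    have "p v \<le> 0" "p (- v) \<le> 0" using le[OF v, of v] le[OF subspace_neg[OF V v], of "- v"] by simp_all
    then have "q v \<le> 0" "q (- v) \<le> 0" using q(2) order_trans by blast+
    then show "blinfun_apply \<phi> v = 0" using linear_neg[OF q(1), of v] by (simp add: \<phi>)
  next
    have "p a \<noteq> 0" using a ne by (simp add: p_def in_closure_iff_infdist_zero)
    then show "blinfun_apply \<phi> a \<noteq> 0" using q(3) by (simp add: \<phi>)
  qed
qed

section \<open>Weakly convergent subsequences in separable reflexive spaces\<close>

text \<open>
  Norming functionals of the points of a countable dense set; the factor one half absorbs the
  distance between a vector and the dense set.
\<close>

lemma countable_norming_family:
  obtains \<phi> :: "nat \<Rightarrow> 'a::{real_normed_vector, second_countable_topology} \<Rightarrow>\<^sub>L real"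
  where "\<And>i. norm (\<phi> i) \<le> 1" "\<And>e. \<exists>i. blinfun_apply (\<phi> i) e \<ge> norm e / 2"
proof -
  obtain D :: "'a set" where D: "countable D" "\<And>X. open X \<Longrightarrow> X \<noteq> {} \<Longrightarrow> \<exists>d\<in>D. d \<in> X"
    using countable_dense_setE by blast
  then have ne: "D \<noteq> {}" by (metis UNIV_I empty_iff open_UNIV)
  have "\<exists>\<psi> :: 'a \<Rightarrow>\<^sub>L real. norm \<psi> \<le> 1 \<and> blinfun_apply \<psi> d = norm d" for d
    using norming_functional by blast
  then obtain \<Psi> :: "'a \<Rightarrow> 'a \<Rightarrow>\<^sub>L real" where
    \<Psi>: "\<And>d. norm (\<Psi> d) \<le> 1" "\<And>d. blinfun_apply (\<Psi> d) d = norm d" by metis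
  show ?thesis
  proof (rule that[of "\<lambda>i. \<Psi> (from_nat_into D i)"])
    fix e :: 'a
    show "\<exists>i. norm e / 2 \<le> blinfun_apply (\<Psi> (from_nat_into D i)) e"
    proof (cases "e = 0")
      case False
      then obtain d where d: "d \<in> D" "d \<in> ball e (norm e / 4)"
        using D(2)[of "ball e (norm e / 4)"] by auto
      obtain i where i: "d = from_nat_into D i"
        using d(1) D(1) by (metis from_nat_into_surj)
      have near: "norm (d - e) < norm e / 4" using d(2) by (simp add: dist_norm norm_minus_commute)
      have "\<bar>blinfun_apply (\<Psi> d) (d - e)\<bar> \<le> 1 * norm (d - e)"
        using norm_blinfun[of "\<Psi> d" "d - e"] mult_right_mono[OF \<Psi>(1)[of d], of "norm (d - e)"]
        by simp
      then have "blinfun_apply (\<Psi> d) e \<ge> norm d - norm (d - e)"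
        using \<Psi>(2)[of d] by (simp add: blinfun.diff_right)
      moreover have "norm d \<ge> norm e - norm (d - e)"
        using norm_triangle_sub[of e d] by (simp add: norm_minus_commute)
      ultimately have "blinfun_apply (\<Psi> d) e \<ge> norm e / 2" using near by simp
      then show ?thesis using i by auto
    qed auto
  qed (rule \<Psi>)
qed

text \<open>
  A functional on the dual space that vanishes on the family is, by reflexivity, evaluation at a vector, and a
  norming family annihilates only the zero vector.
\<close>

lemma norming_family_total:
  fixes \<phi> :: "nat \<Rightarrow> 'e::real_normed_vector \<Rightarrow>\<^sub>L real"
  assumes refl: "reflexive_space TYPE('e)"
    and norming: "\<And>e. \<exists>i. blinfun_apply (\<phi> i) e \<ge> norm e / 2"
  shows "closure (span (range \<phi>)) = UNIV"
proof (rule ccontr)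
  assume "closure (span (range \<phi>)) \<noteq> UNIV"
  then obtain \<psi> where "\<psi> \<notin> closure (span (range \<phi>))" by blast
  then obtain \<Phi> :: "('e \<Rightarrow>\<^sub>L real) \<Rightarrow>\<^sub>L real" where
    \<Phi>: "\<And>v. v \<in> span (range \<phi>) \<Longrightarrow> blinfun_apply \<Phi> v = 0" "blinfun_apply \<Phi> \<psi> \<noteq> 0"
    using functional_vanishing_on_subspace[OF subspace_span] by metis
  obtain e where e: "\<And>\<phi>. blinfun_apply \<Phi> \<phi> = blinfun_apply \<phi> e"
    using refl unfolding reflexive_space_def by blast
  obtain i where "blinfun_apply (\<phi> i) e \<ge> norm e / 2" using norming by blast
  moreover have "blinfun_apply (\<phi> i) e = 0"
    using \<Phi>(1)[of "\<phi> i"] e by (simp add: span_base)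
  ultimately show False using \<Phi>(2) e[of \<psi>] by simp
qed

text \<open>
  The diagonal argument, in the form of sequential compactness of a countable product of compact
  intervals.
\<close>

lemma bounded_coordinates_convergent_subseq:
  fixes a :: "nat \<Rightarrow> nat \<Rightarrow> real"
  assumes "\<And>n i. \<bar>a n i\<bar> \<le> R i"
  obtains t where "strict_mono (t :: nat \<Rightarrow> nat)" "\<And>i. convergent (\<lambda>k. a (t k) i)"
proof -
  have "compact (PiE UNIV (\<lambda>i. {- R i..R i}))"
    using compactin_PiE[where X = "\<lambda>_. euclidean" and I = "UNIV :: nat set" and S = "\<lambda>i. {- R i..R i}"]
    by (simp add: euclidean_product_topology)
  then have "seq_compact (PiE UNIV (\<lambda>i. {- R i..R i}))"
    by (simp add: compact_eq_seq_compact_metric)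
  moreover have "a n \<in> PiE UNIV (\<lambda>i. {- R i..R i})" for n
    using assms[of n] by (auto simp: abs_le_iff) (metis minus_le_iff)
  ultimately obtain l t where t: "strict_mono t" "(a \<circ> t) \<longlonglongrightarrow> l"
    unfolding seq_compact_def by metis
  have "(\<lambda>k. a (t k) i) \<longlonglongrightarrow> l i" for i
  proof -
    have "isCont (\<lambda>f :: nat \<Rightarrow> real. f i) l"
      using continuous_on_product_coordinates[of i] continuous_on_eq_continuous_at[OF open_UNIV] by blast
    from isCont_tendsto_compose[OF this t(2)] show ?thesis by (simp add: o_def)
  qed
  then show ?thesis using that t(1) by (auto simp: convergent_def)
qed

text \<open>
  A subsequence along which the members of a norming family converge makes every functional
  converge, because their span is dense and the sequence is bounded. The limit is a bounded functional on the dual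
  space, hence evaluation at the weak limit.
\<close>

lemma reflexive_bounded_weakly_convergent_subseq:
  fixes e :: "nat \<Rightarrow> 'e::{real_normed_vector, second_countable_topology}"
  assumes refl: "reflexive_space TYPE('e)" and bd: "\<And>n. norm (e n) \<le> R"
  obtains t l where "strict_mono (t :: nat \<Rightarrow> nat)" "weakly_tendsto type_space (e \<circ> t) l"
proof -
  obtain \<phi> :: "nat \<Rightarrow> 'e \<Rightarrow>\<^sub>L real" where \<phi>: "\<And>i. norm (\<phi> i) \<le> 1"
    "\<And>e. \<exists>i. blinfun_apply (\<phi> i) e \<ge> norm e / 2"
    using countable_norming_family by blast
  have R: "R \<ge> 0" using bd[of 0] norm_ge_zero order_trans by blast
  have ub: "\<bar>blinfun_apply \<psi> (e n)\<bar> \<le> norm \<psi> * R" for \<psi> :: "'e \<Rightarrow>\<^sub>L real" and n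
    using norm_blinfun[of \<psi> "e n"] mult_left_mono[OF bd[of n], of "norm \<psi>"] by simp
  obtain t where t: "strict_mono t" "\<And>i. convergent (\<lambda>k. blinfun_apply (\<phi> i) (e (t k)))"
    using bounded_coordinates_convergent_subseq[of "\<lambda>n i. blinfun_apply (\<phi> i) (e n)" "\<lambda>i. norm (\<phi> i) * R"] ub
    by blast
  define V where "V = {\<psi> :: 'e \<Rightarrow>\<^sub>L real. convergent (\<lambda>k. blinfun_apply \<psi> (e (t k)))}"
  have "subspace V"
    by (auto simp: subspace_def V_def blinfun.add_left blinfun.scaleR_left convergent_const
        intro: convergent_add convergent_mult)
  then have sp: "span (range \<phi>) \<subseteq> V" using t(2) by (intro span_minimal) (auto simp: V_def)
  have cauchy: "Cauchy (\<lambda>k. blinfun_apply \<psi> (e (t k)))" for \<psi> :: "'e \<Rightarrow>\<^sub>L real"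
  proof (rule metric_CauchyI)
    fix \<epsilon> :: real assume \<epsilon>: "\<epsilon> > 0"
    define \<delta> where "\<delta> = \<epsilon> / (4 * (R + 1))"
    have \<delta>: "\<delta> > 0" "\<delta> * R < \<epsilon> / 3" using \<epsilon> R by (simp_all add: \<delta>_def field_simps add_nonneg_pos)
    obtain \<psi>' where \<psi>': "\<psi>' \<in> V" "dist \<psi>' \<psi> < \<delta>"
      using norming_family_total[OF refl \<phi>(2)] sp \<delta>(1)
      by (metis UNIV_I closure_approachable subsetD)
    obtain N where N: "\<And>m n. m \<ge> N \<Longrightarrow> n \<ge> N \<Longrightarrow>
        dist (blinfun_apply \<psi>' (e (t m))) (blinfun_apply \<psi>' (e (t n))) < \<epsilon> / 3"
      using \<psi>'(1) \<epsilon> unfolding V_def by (metis (mono_tags, lifting) convergent_Cauchy mem_Collect_eq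
          metric_CauchyD zero_less_divide_iff zero_less_numeral)
    have near: "\<bar>blinfun_apply \<psi>' (e n) - blinfun_apply \<psi> (e n)\<bar> < \<epsilon> / 3" for n
    proof -
      have "\<bar>blinfun_apply (\<psi>' - \<psi>) (e n)\<bar> \<le> norm (\<psi>' - \<psi>) * R" by (rule ub)
      also have "\<dots> \<le> \<delta> * R" using \<psi>'(2) R by (intro mult_right_mono) (simp_all add: dist_norm)
      finally show ?thesis using \<delta>(2) by (simp add: blinfun.diff_left)
    qed
    show "\<exists>M. \<forall>m\<ge>M. \<forall>n\<ge>M. dist (blinfun_apply \<psi> (e (t m))) (blinfun_apply \<psi> (e (t n))) < \<epsilon>"
    proof (intro exI allI impI)
      fix m n assume "m \<ge> N" "n \<ge> N"
      from N[OF this] near[of "t m"] near[of "t n"]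
      show "dist (blinfun_apply \<psi> (e (t m))) (blinfun_apply \<psi> (e (t n))) < \<epsilon>"
        unfolding dist_real_def by linarith
    qed
  qed
  define F where "F \<psi> = lim (\<lambda>k. blinfun_apply \<psi> (e (t k)))" for \<psi> :: "'e \<Rightarrow>\<^sub>L real"
  have F: "(\<lambda>k. blinfun_apply \<psi> (e (t k))) \<longlonglongrightarrow> F \<psi>" for \<psi>
    using Cauchy_convergent[OF cauchy] by (simp add: F_def convergent_LIMSEQ_iff)
  have "bounded_linear F"
  proof (rule bounded_linear_intro[of _ R])
    fix \<psi> \<psi>' :: "'e \<Rightarrow>\<^sub>L real" and c :: real
    show "F (\<psi> + \<psi>') = F \<psi> + F \<psi>'"
      by (rule LIMSEQ_unique[OF F]) (auto simp: blinfun.add_left intro: tendsto_add F)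
    show "F (c *\<^sub>R \<psi>) = c *\<^sub>R F \<psi>"
      by (rule LIMSEQ_unique[OF F]) (auto simp: blinfun.scaleR_left intro: tendsto_mult_left F)
    show "norm (F \<psi>) \<le> norm \<psi> * R"
      using tendsto_norm[OF F[of \<psi>]] by (rule LIMSEQ_le_const2) (use ub in auto)
  qed
  then have "\<exists>l. \<forall>\<psi>. F \<psi> = blinfun_apply \<psi> l"
    using refl unfolding reflexive_space_def by (metis bounded_linear_Blinfun_apply)
  then obtain l where l: "\<And>\<psi>. F \<psi> = blinfun_apply \<psi> l" by blast
  have "weakly_tendsto type_space (e \<circ> t) l"
    unfolding weakly_tendsto_def dual_type_space
  proof (intro conjI ballI)
    fix \<psi> :: "'e \<Rightarrow> real" assume "\<psi> \<in> {\<phi>. bounded_linear \<phi>}"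
    then show "(\<lambda>n. \<psi> ((e \<circ> t) n)) \<longlonglongrightarrow> \<psi> l"
      using F[of "Blinfun \<psi>"] l[of "Blinfun \<psi>"] by (simp add: bounded_linear_Blinfun_apply)
  qed (auto simp: type_space_def)
  then show ?thesis using that t(1) by blast
qed

section \<open>Bounded functionals on the space of integrable functions\<close>

abbreviation cut :: "'w set \<Rightarrow> ('w \<Rightarrow> 'e::real_normed_vector) \<Rightarrow> 'w \<Rightarrow> 'e" where
  "cut A x \<equiv> \<lambda>\<omega>. indicator A \<omega> *\<^sub>R x \<omega>"

lemma L1_space_simps [simp]:
  "pts (L1_space M) = {x. integrable M x}"
  "add (L1_space M) = (\<lambda>x y \<omega>. x \<omega> + y \<omega>)"
  "scl (L1_space M) = (\<lambda>c x \<omega>. c *\<^sub>R x \<omega>)"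
  "nrm (L1_space M) = L1_norm M"
  by (simp_all add: L1_space_def)

lemma L1_norm_nonneg [simp]: "L1_norm M x \<ge> 0"
  by (simp add: L1_norm_def)

lemma dual_L1_linear:
  assumes "\<phi> \<in> dual (L1_space M)" "integrable M x" "integrable M y"
  shows "\<phi> (\<lambda>\<omega>. x \<omega> + y \<omega>) = \<phi> x + \<phi> y" "\<phi> (\<lambda>\<omega>. c *\<^sub>R x \<omega>) = c * \<phi> x"
    "\<phi> (\<lambda>\<omega>. x \<omega> - y \<omega>) = \<phi> x - \<phi> y"
proof -
  have add: "\<phi> (\<lambda>\<omega>. u \<omega> + v \<omega>) = \<phi> u + \<phi> v" if "integrable M u" "integrable M v" for u v
    using assms(1) that by (auto simp: dual_def)
  have scale: "\<phi> (\<lambda>\<omega>. c *\<^sub>R u \<omega>) = c * \<phi> u" if "integrable M u" for c u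
    using assms(1) that by (auto simp: dual_def)
  show "\<phi> (\<lambda>\<omega>. x \<omega> + y \<omega>) = \<phi> x + \<phi> y" "\<phi> (\<lambda>\<omega>. c *\<^sub>R x \<omega>) = c * \<phi> x"
    using add scale assms by auto
  have "\<phi> (\<lambda>\<omega>. x \<omega> + (-1) *\<^sub>R y \<omega>) = \<phi> x + (-1) * \<phi> y"
    unfolding add[OF assms(2) Bochner_Integration.integrable_scaleR_right[OF assms(3)]] scale[OF assms(3)] ..
  then show "\<phi> (\<lambda>\<omega>. x \<omega> - y \<omega>) = \<phi> x - \<phi> y" by simp
qed

lemma dual_L1_zero: "\<phi> \<in> dual (L1_space M) \<Longrightarrow> \<phi> (\<lambda>\<omega>. 0) = 0"
  using dual_L1_linear(2)[of \<phi> M "\<lambda>_. 0" "\<lambda>_. 0" 0] by simp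

lemma dual_L1_bound:
  assumes "\<phi> \<in> dual (L1_space M)"
  obtains C where "C \<ge> 0" "\<And>x. integrable M x \<Longrightarrow> \<bar>\<phi> x\<bar> \<le> C * L1_norm M x"
proof -
  obtain C where C: "\<And>x. integrable M x \<Longrightarrow> \<bar>\<phi> x\<bar> \<le> C * L1_norm M x"
    using assms by (auto simp: dual_def)
  have "C * L1_norm M x \<le> max C 0 * L1_norm M x" for x by (intro mult_right_mono) auto
  then show ?thesis using C that[of "max C 0"] order_trans by (metis max.cobounded2)
qed

lemma integrable_cut:
  fixes x :: "'w \<Rightarrow> 'e::{banach, second_countable_topology}"
  shows "integrable M x \<Longrightarrow> A \<in> sets M \<Longrightarrow> integrable M (cut A x)"
  by (rule integrable_mult_indicator)

lemma dual_L1_cut: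
  fixes M :: "'w measure" and \<phi> :: "('w \<Rightarrow> 'e::{banach, second_countable_topology}) \<Rightarrow> real"
  assumes \<phi>: "\<phi> \<in> dual (L1_space M)" and A: "A \<in> sets M"
  shows "(\<lambda>x. \<phi> (cut A x)) \<in> dual (L1_space M)"
proof -
  obtain C where C: "C \<ge> 0" "\<And>x. integrable M x \<Longrightarrow> \<bar>\<phi> x\<bar> \<le> C * L1_norm M x"
    using dual_L1_bound[OF \<phi>] by blast
  have add: "\<phi> (\<lambda>\<omega>. indicator A \<omega> *\<^sub>R (x \<omega> + y \<omega>)) = \<phi> (cut A x) + \<phi> (cut A y)"
    if "integrable M x" "integrable M y" for x y :: "'w \<Rightarrow> 'e"
    using dual_L1_linear(1)[OF \<phi> that[THEN integrable_cut[OF _ A]]] by (simp add: scaleR_add_right)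
  have scale: "\<phi> (\<lambda>\<omega>. indicator A \<omega> *\<^sub>R c *\<^sub>R x \<omega>) = c * \<phi> (cut A x)"
    if "integrable M x" for c and x :: "'w \<Rightarrow> 'e"
    using dual_L1_linear(2)[OF \<phi> that[THEN integrable_cut[OF _ A]] that[THEN integrable_cut[OF _ A]], of c]
    by (simp add: mult.commute)
  have bound: "\<bar>\<phi> (cut A x)\<bar> \<le> C * L1_norm M x" if x: "integrable M x" for x :: "'w \<Rightarrow> 'e"
  proof -
    have "\<bar>\<phi> (cut A x)\<bar> \<le> C * L1_norm M (cut A x)" using C(2) integrable_cut[OF x A] .
    also have "L1_norm M (cut A x) \<le> L1_norm M x" unfolding L1_norm_def
      using x A by (intro integral_mono integrable_norm integrable_cut) (auto simp: indicator_def)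
    finally show ?thesis using C(1) by (simp add: mult_left_mono)
  qed
  show ?thesis using add scale bound by (auto simp: dual_def)
qed

lemma weakly_tendsto_compose:
  assumes "weakly_tendsto Y y l" "filterlim g sequentially sequentially"
  shows "weakly_tendsto Y (y \<circ> g) l"
  using assms filterlim_compose[of _ _ sequentially g sequentially]
  by (force simp: weakly_tendsto_def o_def)

lemma weakly_tendsto_L1_diff:
  assumes "weakly_tendsto (L1_space M) x l"
  shows "weakly_tendsto (L1_space M) (\<lambda>n \<omega>. x n \<omega> - l \<omega>) (\<lambda>_. 0)"
proof -
  have int: "integrable M (x n)" "integrable M l" for n
    using assms by (auto simp: weakly_tendsto_def)
  show ?thesis using assms int
    by (auto simp: weakly_tendsto_def dual_L1_linear(3) dual_L1_zero intro!: LIM_zero)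
qed

lemma L1_tendsto_zero_imp_weakly:
  fixes x :: "nat \<Rightarrow> 'w \<Rightarrow> 'e::{banach, second_countable_topology}"
  assumes "\<And>n. integrable M (x n)" "(\<lambda>n. L1_norm M (x n)) \<longlonglongrightarrow> 0"
  shows "weakly_tendsto (L1_space M) x (\<lambda>_. 0)"
  unfolding weakly_tendsto_def
proof (intro conjI ballI)
  fix \<phi> :: "('w \<Rightarrow> 'e) \<Rightarrow> real" assume \<phi>: "\<phi> \<in> dual (L1_space M)"
  obtain C where C: "C \<ge> 0" "\<And>x. integrable M x \<Longrightarrow> \<bar>\<phi> x\<bar> \<le> C * L1_norm M x"
    using dual_L1_bound[OF \<phi>] by blast
  have "(\<lambda>n. C * L1_norm M (x n)) \<longlonglongrightarrow> 0" using assms(2) by (rule tendsto_mult_right_zero)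
  then have "(\<lambda>n. \<phi> (x n)) \<longlonglongrightarrow> 0"
    by (rule Lim_null_comparison[rotated]) (use C assms(1) in auto)
  then show "(\<lambda>n. \<phi> (x n)) \<longlonglongrightarrow> \<phi> (\<lambda>_. 0)" using dual_L1_zero[OF \<phi>] by simp
qed (use assms(1) in auto)

text \<open>
  At each point one uses the first member of a countable norming family that works there, so that the choice
  is measurable.
\<close>

lemma L1_norming_functional:
  fixes z :: "'w \<Rightarrow> 'e::{banach, second_countable_topology}"
  assumes z: "integrable M z"
  obtains \<psi> where "\<psi> \<in> dual (L1_space M)" "\<And>y. integrable M y \<Longrightarrow> \<bar>\<psi> y\<bar> \<le> L1_norm M y"
    "\<psi> z \<ge> L1_norm M z / 2"
proof -
  obtain \<phi> :: "nat \<Rightarrow> 'e \<Rightarrow>\<^sub>L real" where \<phi>: "\<And>i. norm (\<phi> i) \<le> 1"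
    "\<And>e. \<exists>i. blinfun_apply (\<phi> i) e \<ge> norm e / 2"
    using countable_norming_family by blast
  define i where "i \<omega> = (LEAST i. blinfun_apply (\<phi> i) (z \<omega>) \<ge> norm (z \<omega>) / 2)" for \<omega>
  have i: "blinfun_apply (\<phi> (i \<omega>)) (z \<omega>) \<ge> norm (z \<omega>) / 2" for \<omega>
    unfolding i_def using \<phi>(2)[of "z \<omega>"] by (rule LeastI_ex)
  have ap: "(\<lambda>\<omega>. blinfun_apply (\<phi> k) (y \<omega>)) \<in> borel_measurable M"
    if "y \<in> borel_measurable M" for y k
    using that by (rule borel_measurable_continuous_on[rotated])
      (intro linear_continuous_on blinfun.bounded_linear_right)
  have [measurable]: "z \<in> borel_measurable M" using z by simp
  note ap[OF this, measurable]
  have im [measurable]: "i \<in> M \<rightarrow>\<^sub>M count_space UNIV" unfolding i_def by measurable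
  have le: "\<bar>blinfun_apply (\<phi> k) e\<bar> \<le> norm e" for k e
    using norm_blinfun[of "\<phi> k" e] mult_right_mono[OF \<phi>(1)[of k], of "norm e"] by simp
  define \<psi> where "\<psi> y = (LINT \<omega>|M. blinfun_apply (\<phi> (i \<omega>)) (y \<omega>))" for y
  have int: "integrable M (\<lambda>\<omega>. blinfun_apply (\<phi> (i \<omega>)) (y \<omega>))" if y: "integrable M y" for y
  proof (rule Bochner_Integration.integrable_bound[OF y])
    show "(\<lambda>\<omega>. blinfun_apply (\<phi> (i \<omega>)) (y \<omega>)) \<in> borel_measurable M"
      by (rule measurable_compose_countable[OF _ im]) (rule ap[OF borel_measurable_integrable[OF y]])
  qed (use le in auto)
  have bd: "\<bar>\<psi> y\<bar> \<le> L1_norm M y" if y: "integrable M y" for y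
  proof -
    have "\<bar>\<psi> y\<bar> \<le> (LINT \<omega>|M. norm (blinfun_apply (\<phi> (i \<omega>)) (y \<omega>)))"
      unfolding \<psi>_def real_norm_def[symmetric] by (rule integral_norm_bound)
    also have "\<dots> \<le> L1_norm M y" unfolding L1_norm_def
      using y int le by (intro integral_mono integrable_norm) auto
    finally show ?thesis .
  qed
  show ?thesis
  proof (rule that[OF _ bd])
    have "\<exists>C. \<forall>x. integrable M x \<longrightarrow> \<bar>\<psi> x\<bar> \<le> C * L1_norm M x"
      using bd by (intro exI[of _ 1]) auto
    then show "\<psi> \<in> dual (L1_space M)"
      by (auto simp: dual_def \<psi>_def int blinfun.add_right blinfun.scaleR_right)
    have "L1_norm M z / 2 = (LINT \<omega>|M. norm (z \<omega>) / 2)" by (simp add: L1_norm_def)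
    also have "\<dots> \<le> \<psi> z" unfolding \<psi>_def using i z int by (intro integral_mono) auto
    finally show "\<psi> z \<ge> L1_norm M z / 2" .
  qed
qed

text \<open>
  The uniform boundedness principle. Suppose \<open>z k\<close> is a subsequence with norms above \<open>8 ^ k\<close>. The functional
  is a series of norming functionals \<open>\<psi> k\<close> of \<open>z k\<close> with weights \<open>\<plusminus> 4 ^ (- k)\<close>, where the sign of
  the \<open>k\<close>-th term agrees with the value at \<open>z k\<close> of the preceding partial sum. The \<open>k\<close>-th term
  then contributes at least \<open>4 ^ (- k) / 2\<close> times the norm of \<open>z k\<close>, and the remaining ones take away
  at most \<open>4 ^ (- k) / 3\<close> times that norm.
\<close>

lemma weakly_convergent_imp_L1_bounded:
  fixes y :: "nat \<Rightarrow> 'w \<Rightarrow> 'e::{banach, second_countable_topology}"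
  assumes y: "weakly_tendsto (L1_space M) y l"
  obtains C where "\<And>n. L1_norm M (y n) \<le> C"
proof (rule ccontr)
  assume "\<not> thesis"
  then have "\<exists>n. L1_norm M (y n) > C" for C using that by (metis not_less)
  then have "\<exists>n. L1_norm M (y n) > 8 ^ k" for k :: nat by blast
  then obtain n where n: "\<And>k :: nat. L1_norm M (y (n k)) > 8 ^ k" by metis
  define z where "z k = y (n k)" for k
  have int: "integrable M (y n)" for n using y by (auto simp: weakly_tendsto_def)
  have "\<exists>\<psi>. \<psi> \<in> dual (L1_space M) \<and> (\<forall>y. integrable M y \<longrightarrow> \<bar>\<psi> y\<bar> \<le> L1_norm M y)
      \<and> \<psi> (z k) \<ge> L1_norm M (z k) / 2" for k
    using L1_norming_functional[of M "z k"] int unfolding z_def by metis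
  then obtain \<psi> where \<psi>: "\<And>k. \<psi> k \<in> dual (L1_space M)"
    "\<And>k y. integrable M y \<Longrightarrow> \<bar>\<psi> k y\<bar> \<le> L1_norm M y" "\<And>k. \<psi> k (z k) \<ge> L1_norm M (z k) / 2"
    by metis
  define S where "S = rec_nat (\<lambda>_. 0)
    (\<lambda>k f x. f x + (if f (z k) \<ge> 0 then 1 else -1) * (1/4) ^ k * \<psi> k x)"
  \<comment> \<open>\<open>S k\<close> is the \<open>k\<close>-th partial sum; its recursive form is needed because \<open>\<sigma> k\<close> refers to it.\<close>
  define \<sigma> :: "nat \<Rightarrow> real" where "\<sigma> k = (if S k (z k) \<ge> 0 then 1 else -1)" for k
  define a where "a = (\<lambda>x k. \<sigma> k * (1/4) ^ k * \<psi> k x)"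
  have S_sum: "S k x = (\<Sum>j<k. a x j)" for k x
    by (induction k) (simp_all add: S_def a_def \<sigma>_def)
  have a_le: "\<bar>a x k\<bar> \<le> (1/4) ^ k * L1_norm M x" if "integrable M x" for x k
    using mult_left_mono[OF \<psi>(2)[OF that, of k], of "(1/4) ^ k"] by (simp add: a_def \<sigma>_def abs_mult)
  have summ: "summable (a x)" if "integrable M x" for x
    by (rule summable_comparison_test'[of "\<lambda>k. (1/4) ^ k * L1_norm M x" 0])
      (use a_le[OF that] in \<open>auto intro!: summable_mult2 summable_geometric\<close>)
  define \<phi> where "\<phi> x = suminf (a x)" for x
  have tail: "\<bar>\<phi> x - S k x\<bar> \<le> (1/4) ^ k * (4/3) * L1_norm M x" if x: "integrable M x" for x k
  proof -
    have geo: "(\<lambda>j. (1/4) ^ (j + k) * L1_norm M x) sums ((1/4) ^ k * (4/3) * L1_norm M x)"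
      using sums_mult2[OF geometric_sums[of "1/4 :: real"], of "(1/4) ^ k * L1_norm M x"]
      by (simp add: power_add mult_ac)
    have "\<phi> x - S k x = (\<Sum>j. a x (j + k))"
      using suminf_split_initial_segment[OF summ[OF x], of k] by (simp add: \<phi>_def S_sum)
    also have "\<bar>\<dots>\<bar> \<le> (\<Sum>j. (1/4) ^ (j + k) * L1_norm M x)"
      using norm_suminf_le[of "\<lambda>j. a x (j + k)" "\<lambda>j. (1/4) ^ (j + k) * L1_norm M x"]
        a_le[OF x] sums_summable[OF geo] by simp
    finally show ?thesis using sums_unique[OF geo] by simp
  qed
  have "\<phi> \<in> dual (L1_space M)"
  proof -
    have "\<phi> (\<lambda>\<omega>. x \<omega> + y \<omega>) = \<phi> x + \<phi> y" if "integrable M x" "integrable M y" for x y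
      using suminf_add[OF that[THEN summ]] dual_L1_linear(1)[OF \<psi>(1) that]
      by (simp add: \<phi>_def a_def algebra_simps)
    moreover have "\<phi> (\<lambda>\<omega>. c *\<^sub>R x \<omega>) = c * \<phi> x" if "integrable M x" for c x
      using suminf_mult[OF summ[OF that], of c] dual_L1_linear(2)[OF \<psi>(1) that that]
      by (simp add: \<phi>_def a_def mult_ac)
    moreover have "\<exists>C. \<forall>x. integrable M x \<longrightarrow> \<bar>\<phi> x\<bar> \<le> C * L1_norm M x"
      using tail[of _ 0] by (intro exI[of _ "4/3"]) (simp add: S_sum)
    ultimately show ?thesis by (simp add: dual_def)
  qed
  then have "(\<lambda>n. \<phi> (y n)) \<longlonglongrightarrow> \<phi> l" using y by (simp add: weakly_tendsto_def)
  then obtain B where B: "\<And>n. \<bar>\<phi> (y n)\<bar> \<le> B"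
    using convergent_imp_Bseq[of "\<lambda>n. \<phi> (y n)"] by (auto simp: convergent_def Bseq_def)
  have big: "\<bar>\<phi> (z k)\<bar> \<ge> 2 ^ k / 6" for k
  proof -
    define N where "N = L1_norm M (z k)"
    have N: "8 ^ k \<le> N" using n[of k] by (simp add: N_def z_def)
    define P where "P = (1/4) ^ k * N"
    have sign: "\<bar>s + (if s \<ge> 0 then 1 else -1) * t\<bar> = \<bar>s\<bar> + t" if "t \<ge> 0" for s t :: real
      using that by (simp add: abs_if)
    have "\<psi> k (z k) \<ge> 0" using \<psi>(3)[of k] L1_norm_nonneg[of M "z k"] by linarith
    then have "(1/4) ^ k * \<psi> k (z k) \<ge> 0" by simp
    moreover have "S (Suc k) (z k) = S k (z k) + \<sigma> k * ((1/4) ^ k * \<psi> k (z k))"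
      by (simp add: S_sum a_def)
    ultimately have S: "\<bar>S (Suc k) (z k)\<bar> = \<bar>S k (z k)\<bar> + (1/4) ^ k * \<psi> k (z k)"
      using sign unfolding \<sigma>_def by metis
    have "(1/4) ^ k * (N / 2) \<le> (1/4) ^ k * \<psi> k (z k)"
      using \<psi>(3)[of k] by (intro mult_left_mono) (simp_all add: N_def)
    then have "P / 2 \<le> (1/4) ^ k * \<psi> k (z k)" by (simp add: P_def)
    moreover have "\<bar>\<phi> (z k) - S (Suc k) (z k)\<bar> \<le> P / 3"
      using tail[of "z k" "Suc k"] int by (simp add: P_def N_def z_def)
    ultimately have le: "P / 6 \<le> \<bar>\<phi> (z k)\<bar>" using S by arith
    have "(1/4) ^ k * 8 ^ k \<le> P" using N unfolding P_def by (intro mult_left_mono) auto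
    moreover have "(1/4) ^ k * 8 ^ k = (2 :: real) ^ k" by (simp flip: power_mult_distrib)
    ultimately show ?thesis using le by simp
  qed
  obtain k where "6 * B < 2 ^ k" using real_arch_pow[of 2 "6 * B"] by auto
  then show False using big[of k] B[of "n k"] by (simp add: z_def)
qed

section \<open>Restriction to escaping sets\<close>

text \<open>
  On a finite measure space, a bounded family is uniformly integrable if and only if its integrals over
  sets of measure tending to zero tend to zero. For \<open>\<sigma>\<close>-finite measures, sequences of sets that almost every point eventually
  leaves take both requirements into account: small sets and complements of large sets of
  finite measure.
\<close>

definition escaping :: "'w measure \<Rightarrow> (nat \<Rightarrow> 'w set) \<Rightarrow> bool" where
  "escaping M A \<longleftrightarrow> range A \<subseteq> sets M \<and> (AE \<omega> in M. \<forall>\<^sub>F n in sequentially. \<omega> \<notin> A n)"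

lemma escaping_sets: "escaping M A \<Longrightarrow> A n \<in> sets M"
  by (auto simp: escaping_def)

lemma escaping_subset:
  "escaping M A \<Longrightarrow> (\<And>n. B n \<in> sets M) \<Longrightarrow> (\<And>n. B n \<subseteq> A n) \<Longrightarrow> escaping M B"
  by (auto simp: escaping_def elim!: eventually_mono)

lemma escaping_compose:
  assumes A: "escaping M A" and g: "filterlim g sequentially sequentially"
  shows "escaping M (\<lambda>n. A (g n))"
proof -
  have "\<forall>\<^sub>F n in sequentially. \<omega> \<notin> A (g n)" if "\<forall>\<^sub>F n in sequentially. \<omega> \<notin> A n" for \<omega>
    using eventually_compose_filterlim[OF that g] .
  moreover have "AE \<omega> in M. \<forall>\<^sub>F n in sequentially. \<omega> \<notin> A n" using A by (simp add: escaping_def)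
  ultimately have "AE \<omega> in M. \<forall>\<^sub>F n in sequentially. \<omega> \<notin> A (g n)" by (rule eventually_mono[rotated])
  then show ?thesis using A by (auto simp: escaping_def)
qed

lemma escaping_UN:
  assumes "escaping M A"
  shows "escaping M (\<lambda>N. \<Union>m\<in>{N..}. A m)"
proof -
  have "\<forall>\<^sub>F N in sequentially. \<omega> \<notin> (\<Union>m\<in>{N..}. A m)" if "\<forall>\<^sub>F n in sequentially. \<omega> \<notin> A n" for \<omega>
  proof -
    obtain N where "\<And>n. n \<ge> N \<Longrightarrow> \<omega> \<notin> A n" using \<open>\<forall>\<^sub>F n in sequentially. \<omega> \<notin> A n\<close> unfolding eventually_sequentially by blast
    then show ?thesis unfolding eventually_sequentially by (intro exI[of _ N]) auto
  qed
  moreover have "AE \<omega> in M. \<forall>\<^sub>F n in sequentially. \<omega> \<notin> A n" using assms by (simp add: escaping_def)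
  ultimately have "AE \<omega> in M. \<forall>\<^sub>F N in sequentially. \<omega> \<notin> (\<Union>m\<in>{N..}. A m)" by (rule eventually_mono[rotated])
  moreover have "(\<Union>m\<in>{N..}. A m) \<in> sets M" for N using assms by (auto simp: escaping_def)
  ultimately show ?thesis by (auto simp: escaping_def)
qed

lemma tendsto_integral_escaping:
  fixes z :: "'w \<Rightarrow> 'e::{banach, second_countable_topology}"
  assumes z: "integrable M z" and A: "escaping M A"
  shows "(\<lambda>n. L1_norm M (cut (A n) z)) \<longlonglongrightarrow> 0"
proof -
  have "(\<lambda>n. LINT \<omega>|M. norm (cut (A n) z \<omega>)) \<longlonglongrightarrow> (LINT \<omega>|M. 0)"
  proof (rule integral_dominated_convergence[where w = "\<lambda>\<omega>. norm (z \<omega>)"])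
    show "AE \<omega> in M. (\<lambda>n. norm (cut (A n) z \<omega>)) \<longlonglongrightarrow> 0"
      using A unfolding escaping_def
      by (auto elim!: eventually_mono intro!: tendsto_eventually)
    show "(\<lambda>\<omega>. norm (cut (A n) z \<omega>)) \<in> borel_measurable M" for n
      using borel_measurable_integrable[OF integrable_cut[OF z escaping_sets[OF A]]] by (rule measurable_compose[OF _ borel_measurable_norm])
  qed (use z in \<open>auto simp: indicator_def\<close>)
  then show ?thesis by (simp add: L1_norm_def)
qed

lemma gliding_subsequence:
  fixes P :: "nat \<Rightarrow> bool" and Q :: "nat \<Rightarrow> nat \<Rightarrow> bool"
  assumes freq: "\<And>N. \<exists>n\<ge>N. P n" and ev: "\<And>n. \<forall>\<^sub>F m in sequentially. Q n m"
  obtains t where "strict_mono (t :: nat \<Rightarrow> nat)" "\<And>k. P (t k)" "\<And>k. Q (t k) (t (Suc k))"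
proof -
  have "\<exists>t. \<forall>k. P (t k) \<and> (t k < t (Suc k) \<and> Q (t k) (t (Suc k)))"
  proof (rule dependent_nat_choice)
    show "\<exists>n. P n" using freq by blast
    fix n and k :: nat
    obtain N where "\<And>m. m \<ge> N \<Longrightarrow> Q n m" using ev unfolding eventually_sequentially by blast
    then show "\<exists>m. P m \<and> (n < m \<and> Q n m)"
      using freq[of "max N (Suc n)"] by (metis Suc_le_lessD max.bounded_iff)
  qed
  then obtain t where "\<forall>k. P (t k) \<and> (t k < t (Suc k) \<and> Q (t k) (t (Suc k)))" by blast
  then show ?thesis using that[of t] by (simp add: strict_mono_Suc_iff)
qed

text \<open>
  The core of the Vitali-Hahn-Saks theorem. Suppose the set functions \<open>\<nu> k B = \<phi> (cut B (z (t k)))\<close>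
  are at least \<open>\<epsilon>\<close> in modulus on \<open>A (t k)\<close>. For each set \<open>G\<close> one of \<open>G \<union> A (t k)\<close> and
  \<open>G - A (t k)\<close> has \<open>\<nu> k\<close>-value at least \<open>\<epsilon> / 2\<close> in modulus, because the difference of the two values is the value on
  \<open>A (t k)\<close>. Choosing this way at each step gives sets \<open>G k\<close>. The subsequence \<open>t\<close> is so sparse that later steps
  change \<open>\<nu> k\<close> by less than \<open>\<epsilon> / 4\<close>. Hence \<open>\<nu> k H\<close> stays away from zero for the limit set \<open>H\<close>, although
  restriction to the fixed set \<open>H\<close> followed by \<open>\<phi>\<close> is a bounded functional.
\<close>

lemma weakly_null_cut_escaping:
  fixes z :: "nat \<Rightarrow> 'w \<Rightarrow> 'e::{banach, second_countable_topology}"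
  assumes z: "weakly_tendsto (L1_space M) z (\<lambda>_. 0)" and A: "escaping M A"
    and \<phi>: "\<phi> \<in> dual (L1_space M)"
  shows "(\<lambda>n. \<phi> (cut (A n) (z n))) \<longlonglongrightarrow> 0"
proof (rule ccontr)
  assume "\<not> ?thesis"
  then obtain \<epsilon> where \<epsilon>: "\<epsilon> > 0" and bad: "\<And>N. \<exists>n\<ge>N. \<bar>\<phi> (cut (A n) (z n))\<bar> \<ge> \<epsilon>"
    unfolding LIMSEQ_iff by (auto simp: not_less)
  have int: "integrable M (z n)" for n using z by (auto simp: weakly_tendsto_def)
  have Am: "A n \<in> sets M" for n using A by (rule escaping_sets)
  obtain C where C: "C \<ge> 0" "\<And>x. integrable M x \<Longrightarrow> \<bar>\<phi> x\<bar> \<le> C * L1_norm M x"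
    using dual_L1_bound[OF \<phi>] by blast
  define U where "U N = (\<Union>m\<in>{N..}. A m)" for N
  have U: "escaping M U" unfolding U_def by (rule escaping_UN[OF A])
  have "\<forall>\<^sub>F m in sequentially. C * L1_norm M (cut (U m) (z n)) < \<epsilon> / 4" for n
    using tendsto_mult_right_zero[OF tendsto_integral_escaping[OF int U], of C n] \<epsilon>
    by (intro order_tendstoD) auto
  then obtain t where t: "strict_mono t"
    "\<And>k. \<bar>\<phi> (cut (A (t k)) (z (t k)))\<bar> \<ge> \<epsilon>"
    "\<And>k. C * L1_norm M (cut (U (t (Suc k))) (z (t k))) < \<epsilon> / 4"
    by (rule gliding_subsequence[OF bad, where Q = "\<lambda>n m. C * L1_norm M (cut (U m) (z n)) < \<epsilon> / 4"]) (rule that)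
  define \<nu> where "\<nu> k B = \<phi> (cut B (z (t k)))" for k B
  define G where "G = rec_nat {} (\<lambda>k G. if \<bar>\<nu> k (G \<union> A (t k))\<bar> \<ge> \<epsilon> / 2 then G \<union> A (t k) else G - A (t k))"
  have G_Suc: "G (Suc k) = (if \<bar>\<nu> k (G k \<union> A (t k))\<bar> \<ge> \<epsilon> / 2 then G k \<union> A (t k) else G k - A (t k))" for k
    by (simp add: G_def)
  have Gm [measurable]: "G k \<in> sets M" for k
  proof (induction k)
    case 0 then show ?case by (simp add: G_def)
  next
    case (Suc k) then show ?case using Am by (simp add: G_Suc)
  qed
  have \<nu>_diff: "\<nu> k B - \<nu> k B' = \<phi> (\<lambda>\<omega>. (indicator B \<omega> - indicator B' \<omega>) *\<^sub>R z (t k) \<omega>)"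
    if "B \<in> sets M" "B' \<in> sets M" for k B B'
    using dual_L1_linear(3)[OF \<phi> integrable_cut[OF int that(1)] integrable_cut[OF int that(2)]]
    by (simp add: \<nu>_def scaleR_diff_left)
  have big: "\<bar>\<nu> k (G (Suc k))\<bar> \<ge> \<epsilon> / 2" for k
  proof -
    have "(\<lambda>\<omega>. (indicator (G k \<union> A (t k)) \<omega> - indicator (G k - A (t k)) \<omega>) *\<^sub>R z (t k) \<omega>) = cut (A (t k)) (z (t k))"
      by (auto simp: indicator_def)
    then have "\<nu> k (G k \<union> A (t k)) - \<nu> k (G k - A (t k)) = \<phi> (cut (A (t k)) (z (t k)))"
      using \<nu>_diff[of "G k \<union> A (t k)" "G k - A (t k)" k] Am Gm by simp
    then show ?thesis using t(2)[of k] by (auto simp: G_Suc)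
  qed
  \<comment> \<open>A point outside \<open>U (t (Suc k))\<close> is in none of the sets added or removed after step \<open>k\<close>.\<close>
  define H where "H = (\<Union>i. \<Inter>j\<in>{i..}. G j)"
  have Hm: "H \<in> sets M" unfolding H_def by measurable
  have H_iff: "\<omega> \<in> H \<longleftrightarrow> \<omega> \<in> G (Suc k)" if \<omega>: "\<omega> \<notin> U (t (Suc k))" for \<omega> k
  proof -
    have stay: "\<omega> \<in> G j \<longleftrightarrow> \<omega> \<in> G (Suc k)" if "j \<ge> Suc k" for j
      using that
    proof (induction j rule: dec_induct)
      case (step j)
      have "t (Suc k) \<le> t j" using step(1) t(1) by (simp add: strict_mono_less_eq)
      then have "\<omega> \<notin> A (t j)" using \<omega> by (auto simp: U_def)
      then show ?case using step.IH by (auto simp: G_Suc)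
    qed simp
    show ?thesis
    proof
      assume "\<omega> \<in> H"
      then obtain i where "\<And>j. j \<ge> i \<Longrightarrow> \<omega> \<in> G j" by (auto simp: H_def)
      then show "\<omega> \<in> G (Suc k)" using stay[of "max i (Suc k)"] by auto
    next
      assume "\<omega> \<in> G (Suc k)"
      then have "\<omega> \<in> (\<Inter>j\<in>{Suc k..}. G j)" using stay by blast
      then show "\<omega> \<in> H" unfolding H_def by blast
    qed
  qed
  have H_big: "\<bar>\<nu> k H\<bar> \<ge> \<epsilon> / 4" for k
  proof -
    have "\<bar>\<nu> k H - \<nu> k (G (Suc k))\<bar>
        \<le> C * L1_norm M (\<lambda>\<omega>. (indicator H \<omega> - indicator (G (Suc k)) \<omega>) *\<^sub>R z (t k) \<omega>)"
      unfolding \<nu>_diff[OF Hm Gm]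
      using integrable_cut[OF int Hm] integrable_cut[OF int Gm]
      by (intro C(2)) (simp add: scaleR_diff_left)
    also have "\<dots> \<le> C * L1_norm M (cut (U (t (Suc k))) (z (t k)))"
      unfolding L1_norm_def
    proof (intro mult_left_mono integral_mono C(1) integrable_norm)
      show "integrable M (\<lambda>\<omega>. (indicator H \<omega> - indicator (G (Suc k)) \<omega>) *\<^sub>R z (t k) \<omega>)"
        using integrable_cut[OF int Hm] integrable_cut[OF int Gm] by (simp add: scaleR_diff_left)
      show "integrable M (cut (U (t (Suc k))) (z (t k)))"
        by (rule integrable_cut[OF int escaping_sets[OF U]])
      show "norm ((indicator H \<omega> - indicator (G (Suc k)) \<omega>) *\<^sub>R z (t k) \<omega>)
          \<le> norm (cut (U (t (Suc k))) (z (t k)) \<omega>)" for \<omega>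
        using H_iff[of \<omega> k] by (auto simp: indicator_def)
    qed
    also have "\<dots> < \<epsilon> / 4" by (rule t(3))
    finally show ?thesis using big[of k] by linarith
  qed
  have "(\<lambda>n. \<phi> (cut H (z n))) \<longlonglongrightarrow> 0"
  proof -
    have "(\<lambda>n. \<phi> (cut H (z n))) \<longlonglongrightarrow> \<phi> (cut H (\<lambda>_. 0))"
      using z dual_L1_cut[OF \<phi> Hm] by (auto simp: weakly_tendsto_def)
    then show ?thesis using dual_L1_zero[OF \<phi>] by simp
  qed
  then have "(\<lambda>k. \<nu> k H) \<longlonglongrightarrow> 0"
    using LIMSEQ_subseq_LIMSEQ[OF _ t(1)] by (fastforce simp: \<nu>_def o_def)
  then have "\<forall>\<^sub>F k in sequentially. \<bar>\<nu> k H\<bar> < \<epsilon> / 4"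
    using \<epsilon> by (auto dest!: tendstoD[where e = "\<epsilon> / 4"])
  then show False using H_big by (auto simp: eventually_sequentially not_less[symmetric])
qed

lemma weakly_tendsto_cut_escaping:
  fixes x :: "nat \<Rightarrow> 'w \<Rightarrow> 'e::{banach, second_countable_topology}"
  assumes x: "weakly_tendsto (L1_space M) x l" and A: "escaping M A"
  shows "weakly_tendsto (L1_space M) (\<lambda>n. cut (A n) (x n)) (\<lambda>_. 0)"
  unfolding weakly_tendsto_def
proof (intro conjI ballI)
  have int: "integrable M (x n)" "integrable M l" for n
    using x by (auto simp: weakly_tendsto_def)
  note ic = integrable_cut[OF _ escaping_sets[OF A]]
  show "range (\<lambda>n. cut (A n) (x n)) \<subseteq> pts (L1_space M)" using ic[OF int(1)] by auto
  fix \<phi> :: "('w \<Rightarrow> 'e) \<Rightarrow> real" assume \<phi>: "\<phi> \<in> dual (L1_space M)"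
  have "weakly_tendsto (L1_space M) (\<lambda>n. cut (A n) l) (\<lambda>_. 0)"
    by (rule L1_tendsto_zero_imp_weakly[OF ic[OF int(2)] tendsto_integral_escaping[OF int(2) A]])
  then have "(\<lambda>n. \<phi> (cut (A n) l)) \<longlonglongrightarrow> \<phi> (\<lambda>_. 0)" using \<phi> by (auto simp: weakly_tendsto_def)
  from tendsto_add[OF weakly_null_cut_escaping[OF weakly_tendsto_L1_diff[OF x] A \<phi>] this]
  show "(\<lambda>n. \<phi> (cut (A n) (x n))) \<longlonglongrightarrow> \<phi> (\<lambda>_. 0)"
    using dual_L1_linear(3)[OF \<phi> ic[OF int(1)] ic[OF int(2)]] by (simp add: scaleR_diff_right)
qed simp

text \<open>
  A sequence in the range visits one term infinitely often, or its indices tend to infinity.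
\<close>

lemma weakly_convergent_imp_rel_seq_weakly_compact:
  assumes y: "weakly_tendsto Y y l"
  shows "rel_seq_weakly_compact Y (range y)"
  unfolding rel_seq_weakly_compact_def
proof (intro conjI allI impI)
  show "range y \<subseteq> pts Y" using y by (simp add: weakly_tendsto_def)
  fix z :: "nat \<Rightarrow> 'a" assume "range z \<subseteq> range y"
  then have "\<forall>k. \<exists>n. z k = y n" by blast
  then obtain g where g: "\<And>k. z k = y (g k)" by metis
  show "\<exists>l s. strict_mono s \<and> weakly_tendsto Y (z \<circ> s) l"
  proof (cases "\<exists>n. infinite {k. g k = n}")
    case True
    then obtain n where "infinite {k. g k = n}" by blast
    then obtain s :: "nat \<Rightarrow> nat" where s: "strict_mono s" "\<And>k. s k \<in> {k. g k = n}"
      using infinite_enumerate by blast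
    then have "z \<circ> s = (\<lambda>_. y n)" using g by auto
    moreover have "weakly_tendsto Y (\<lambda>_. y n) (y n)" using y by (auto simp: weakly_tendsto_def)
    ultimately show ?thesis using s(1) by (intro exI[of _ "y n"] exI[of _ s]) simp
  next
    case False
    have "filterlim g sequentially sequentially"
      unfolding filterlim_at_top
    proof
      fix N
      have "{k. g k < N} = (\<Union>n\<in>{..<N}. {k. g k = n})" by auto
      then have "finite {k. \<not> N \<le> g k}" using False by (simp add: not_le)
      then show "\<forall>\<^sub>F k in sequentially. N \<le> g k"
        by (simp add: eventually_cofinite flip: cofinite_eq_sequentially)
    qed
    then have "weakly_tendsto Y (y \<circ> g) l" by (rule weakly_tendsto_compose[OF y])
    moreover have "z \<circ> id = y \<circ> g" using g by auto
    ultimately show ?thesis using strict_mono_id by metis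
  qed
qed

section \<open>Uniform integrability along escaping sets\<close>

lemma L1_norm_mult_indicator:
  fixes u :: "'w \<Rightarrow> real"
  shows "L1_norm M (\<lambda>\<omega>. u \<omega> * indicator A \<omega>) = L1_norm M (cut A u)"
  by (simp add: L1_norm_def mult.commute)

text \<open>
  The Borel-Cantelli lemma handles the indices of the first kind, exhaustion by \<open>K\<close> those of the second.
\<close>

lemma (in sigma_finite_measure) escaping_if_negligible:
  assumes K: "range K \<subseteq> sets M" "\<Union> (range K) = space M" "incseq K"
    and A: "\<And>k. A k \<in> sets M"
      "\<And>k. emeasure M (A k) \<le> ennreal ((1/2) ^ k) \<or> A k = space M - K k"
  shows "escaping M A"
proof -
  define B where "B k = (if emeasure M (A k) \<le> ennreal ((1/2) ^ k) then A k else {})" for k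
  have Bs: "B k \<in> sets M" for k using A by (simp add: B_def)
  have Be: "emeasure M (B k) \<le> ennreal ((1/2) ^ k)" for k by (simp add: B_def)
  have Bf: "emeasure M (B k) < \<infinity>" for k
    using Be[of k] by (rule le_less_trans) (simp add: ennreal_less_top)
  have Bm: "measure M (B k) \<le> (1/2) ^ k" for k
    using Be[of k] Bf[of k] by (simp add: emeasure_eq_ennreal_measure)
  have "summable (\<lambda>k. measure M (B k))"
    by (rule summable_comparison_test'[of "\<lambda>k. (1/2) ^ k" 0]) (use Bm in \<open>auto intro: summable_geometric\<close>)
  from borel_cantelli_AE1[OF Bs Bf this]
  have "AE \<omega> in M. \<forall>\<^sub>F k in sequentially. \<omega> \<in> space M - B k" .
  moreover have "\<forall>\<^sub>F k in sequentially. \<omega> \<notin> A k"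
    if \<omega>: "\<forall>\<^sub>F k in sequentially. \<omega> \<in> space M - B k" "\<omega> \<in> space M" for \<omega>
  proof -
    obtain i where i: "\<omega> \<in> K i" using K(2) \<omega>(2) by blast
    then have "\<forall>\<^sub>F k in sequentially. \<omega> \<in> K k"
      using K(3) unfolding eventually_sequentially by (metis incseqD subsetD)
    with \<omega>(1) show ?thesis
    proof eventually_elim
      case (elim k) then show ?case using A(2)[of k] by (auto simp: B_def split: if_splits)
    qed
  qed
  ultimately have "AE \<omega> in M. \<forall>\<^sub>F k in sequentially. \<omega> \<notin> A k"
    by (auto intro: AE_mp AE_I2)
  then show ?thesis using A(1) by (auto simp: escaping_def)
qed

text \<open>
  If uniform integrability fails for \<open>\<epsilon>\<close>, then the choice \<open>\<eta> = 2 ^ (- k)\<close> and the \<open>k\<close>-th set of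
  an exhaustion yields a set \<open>A k\<close> and an index \<open>g k\<close> violating it. The sets escape, so no fixed
  function can be responsible for infinitely many violations, and the indices tend to infinity.
\<close>

lemma (in sigma_finite_measure) uniformly_integrableI_escaping:
  fixes v :: "nat \<Rightarrow> 'a \<Rightarrow> real"
  assumes int: "\<And>n. integrable M (v n)" and bd: "\<And>n. L1_norm M (v n) \<le> C"
    and crit: "\<And>g A \<epsilon>. filterlim g sequentially sequentially \<Longrightarrow> escaping M A \<Longrightarrow> \<epsilon> > 0 \<Longrightarrow>
      \<exists>k. L1_norm M (cut (A k) (v (g k))) \<le> \<epsilon>"
  shows "uniformly_integrable M (range v)"
proof -
  have "\<exists>\<eta>>0. \<exists>K\<in>sets M. emeasure M K < \<infinity> \<and>
        (\<forall>A\<in>sets M. emeasure M A \<le> ennreal \<eta> \<longrightarrow>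
           (SUP u\<in>range v. ereal (L1_norm M (\<lambda>\<omega>. u \<omega> * indicator A \<omega>))) < ereal \<epsilon>) \<and>
        (SUP u\<in>range v. ereal (L1_norm M (\<lambda>\<omega>. u \<omega> * indicator (space M - K) \<omega>))) < ereal \<epsilon>"
    if \<epsilon>: "\<epsilon> > 0" for \<epsilon> :: real
  proof (rule ccontr)
    assume neg: "\<not> ?thesis"
    have large: "\<exists>n. L1_norm M (cut A (v n)) > \<epsilon> / 2"
      if "\<not> (SUP u\<in>range v. ereal (L1_norm M (\<lambda>\<omega>. u \<omega> * indicator A \<omega>))) < ereal \<epsilon>" for A
    proof (rule ccontr)
      assume "\<not> ?thesis"
      then have "(SUP u\<in>range v. ereal (L1_norm M (\<lambda>\<omega>. u \<omega> * indicator A \<omega>))) \<le> ereal (\<epsilon> / 2)"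
        by (intro SUP_least) (auto simp: L1_norm_mult_indicator not_less)
      also have "\<dots> < ereal \<epsilon>" using \<epsilon> by simp
      finally show False using that by simp
    qed
    obtain K :: "nat \<Rightarrow> 'a set" where K: "range K \<subseteq> sets M" "\<Union> (range K) = space M"
      "\<And>i. emeasure M (K i) \<noteq> \<infinity>" "incseq K"
      using sigma_finite_incseq by blast
    have "\<exists>A n. A \<in> sets M \<and> (emeasure M A \<le> ennreal ((1/2) ^ k) \<or> A = space M - K k)
        \<and> L1_norm M (cut A (v n)) > \<epsilon> / 2" for k :: nat
    proof -
      have Kk: "K k \<in> sets M" "emeasure M (K k) < \<infinity>" "(1/2 :: real) ^ k > 0"
        using K by (auto simp: less_top)
      have "(\<exists>A\<in>sets M. emeasure M A \<le> ennreal ((1/2) ^ k) \<and>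
            \<not> (SUP u\<in>range v. ereal (L1_norm M (\<lambda>\<omega>. u \<omega> * indicator A \<omega>))) < ereal \<epsilon>) \<or>
          \<not> (SUP u\<in>range v. ereal (L1_norm M (\<lambda>\<omega>. u \<omega> * indicator (space M - K k) \<omega>))) < ereal \<epsilon>"
        using neg Kk by blast
      then show ?thesis
      proof
        assume "\<exists>A\<in>sets M. emeasure M A \<le> ennreal ((1/2) ^ k) \<and>
            \<not> (SUP u\<in>range v. ereal (L1_norm M (\<lambda>\<omega>. u \<omega> * indicator A \<omega>))) < ereal \<epsilon>"
        then obtain A where A: "A \<in> sets M" "emeasure M A \<le> ennreal ((1/2) ^ k)"
          "\<not> (SUP u\<in>range v. ereal (L1_norm M (\<lambda>\<omega>. u \<omega> * indicator A \<omega>))) < ereal \<epsilon>" by blast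
        then show ?thesis using large[OF A(3)] by (intro exI[of _ A]) simp
      next
        assume "\<not> (SUP u\<in>range v. ereal (L1_norm M (\<lambda>\<omega>. u \<omega> * indicator (space M - K k) \<omega>))) < ereal \<epsilon>"
        from large[OF this] show ?thesis using Kk(1) by (intro exI[of _ "space M - K k"]) simp
      qed
    qed
    then obtain A g where A: "\<And>k. A k \<in> sets M"
      "\<And>k. emeasure M (A k) \<le> ennreal ((1/2) ^ k) \<or> A k = space M - K k"
      "\<And>k. L1_norm M (cut (A k) (v (g k))) > \<epsilon> / 2" by metis
    have esc: "escaping M A" by (rule escaping_if_negligible[OF K(1,2,4) A(1,2)])
    have "\<forall>\<^sub>F k in sequentially. N \<le> g k" for N
    proof -
      have "\<forall>\<^sub>F k in sequentially. \<forall>n\<in>{..<N}. L1_norm M (cut (A k) (v n)) < \<epsilon> / 2"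
        by (intro eventually_ball_finite ballI finite_lessThan order_tendstoD(2)[OF tendsto_integral_escaping[OF int esc]])
          (use \<epsilon> in simp)
      then show ?thesis
      proof eventually_elim
        case (elim k) then show ?case using A(3)[of k] by (meson lessThan_iff less_asym not_less)
      qed
    qed
    then have "filterlim g sequentially sequentially" by (simp add: filterlim_at_top)
    from crit[OF this esc, of "\<epsilon> / 2"] show False using A(3) \<epsilon> by (auto simp: not_le[symmetric])
  qed
  then show ?thesis using int bd by (auto simp: uniformly_integrable_def)
qed

text \<open>
  Outside a set \<open>K\<close> of finite measure the integrals are uniformly small, and the measure of \<open>A k \<inter> K\<close>
  tends to zero.
\<close>

lemma uniformly_integrable_escapingD:
  fixes u :: "nat \<Rightarrow> 'w \<Rightarrow> real"
  assumes X: "uniformly_integrable M X" and u: "\<And>k. u k \<in> X" and A: "escaping M A"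
  shows "(\<lambda>k. L1_norm M (cut (A k) (u k))) \<longlonglongrightarrow> 0"
proof (rule tendstoI)
  fix \<epsilon> :: real assume \<epsilon>: "\<epsilon> > 0"
  obtain \<eta> K where \<eta>: "\<eta> > 0" and K: "K \<in> sets M" "emeasure M K < \<infinity>"
    and small: "\<And>A. A \<in> sets M \<Longrightarrow> emeasure M A \<le> ennreal \<eta> \<Longrightarrow>
           (SUP u\<in>X. ereal (L1_norm M (\<lambda>\<omega>. u \<omega> * indicator A \<omega>))) < ereal (\<epsilon> / 2)"
    and tail: "(SUP u\<in>X. ereal (L1_norm M (\<lambda>\<omega>. u \<omega> * indicator (space M - K) \<omega>))) < ereal (\<epsilon> / 2)"
  proof -
    have "\<exists>\<eta>>0. \<exists>K\<in>sets M. emeasure M K < \<infinity> \<and>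
        (\<forall>A\<in>sets M. emeasure M A \<le> ennreal \<eta> \<longrightarrow>
           (SUP u\<in>X. ereal (L1_norm M (\<lambda>\<omega>. u \<omega> * indicator A \<omega>))) < ereal (\<epsilon> / 2)) \<and>
        (SUP u\<in>X. ereal (L1_norm M (\<lambda>\<omega>. u \<omega> * indicator (space M - K) \<omega>))) < ereal (\<epsilon> / 2)"
      using X half_gt_zero[OF \<epsilon>] unfolding uniformly_integrable_def by simp
    then show ?thesis using that by blast
  qed
  have int: "integrable M (u k)" for k using X u by (auto simp: uniformly_integrable_def)
  have As: "A k \<in> sets M" for k using A by (rule escaping_sets)
  have SupD: "L1_norm M (cut B (u k)) < \<epsilon> / 2"
    if "(SUP u\<in>X. ereal (L1_norm M (\<lambda>\<omega>. u \<omega> * indicator B \<omega>))) < ereal (\<epsilon> / 2)" for B k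
    using le_less_trans[OF SUP_upper[OF u] that] by (simp add: L1_norm_mult_indicator)
  have "integrable M (indicator K :: 'w \<Rightarrow> real)" using K by simp
  from tendsto_integral_escaping[OF this A]
  have "\<forall>\<^sub>F k in sequentially. L1_norm M (cut (A k) (indicator K :: 'w \<Rightarrow> real)) < \<eta>"
    using \<eta> by (rule order_tendstoD)
  then show "\<forall>\<^sub>F k in sequentially. dist (L1_norm M (cut (A k) (u k))) 0 < \<epsilon>"
  proof eventually_elim
    case (elim k)
    have "L1_norm M (cut (A k) (indicator K :: 'w \<Rightarrow> real)) = measure M (A k \<inter> K)"
    proof -
      have "norm (cut (A k) (indicator K :: 'w \<Rightarrow> real) \<omega>) = indicator (A k \<inter> K) \<omega>" for \<omega>
        by (auto simp: indicator_def)
      then show ?thesis using As[of k] sets.sets_into_space[OF K(1)] by (simp add: L1_norm_def Int_absorb2 le_infI2 flip: Int_assoc)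
    qed
    moreover have "emeasure M (A k \<inter> K) < \<infinity>"
      using K As by (meson Int_lower2 emeasure_mono le_less_trans)
    ultimately have "emeasure M (A k \<inter> K) \<le> ennreal \<eta>"
      using elim by (simp add: emeasure_eq_ennreal_measure ennreal_leI)
    then have 1: "L1_norm M (cut (A k \<inter> K) (u k)) < \<epsilon> / 2"
      using As K by (intro SupD small) auto
    have 2: "L1_norm M (cut (space M - K) (u k)) < \<epsilon> / 2" by (rule SupD[OF tail])
    have i: "integrable M (\<lambda>\<omega>. norm (cut (A k \<inter> K) (u k) \<omega>))" "integrable M (\<lambda>\<omega>. norm (cut (space M - K) (u k) \<omega>))"
      "integrable M (\<lambda>\<omega>. norm (cut (A k) (u k) \<omega>))"
      using As K by (intro integrable_norm integrable_cut int; auto)+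
    have "L1_norm M (cut (A k) (u k)) \<le>
        (LINT \<omega>|M. norm (cut (A k \<inter> K) (u k) \<omega>) + norm (cut (space M - K) (u k) \<omega>))"
      unfolding L1_norm_def by (intro integral_mono i Bochner_Integration.integrable_add) (auto simp: indicator_def)
    also have "\<dots> = L1_norm M (cut (A k \<inter> K) (u k)) + L1_norm M (cut (space M - K) (u k))"
      using i(1,2) by (simp add: L1_norm_def)
    finally show ?case using 1 2 by (simp add: dist_real_def)
  qed
qed

text \<open>
  The minorants are the truncations of \<open>w\<close> at height \<open>i\<close> to the \<open>i\<close>-th set of an exhaustion. Working with them
  treats infinite integrals, and integrands with infinite values, on the same footing as
  finite ones.
\<close>

lemma (in sigma_finite_measure) integrable_minorant_of_large_integral:
  fixes w :: "'a \<Rightarrow> ennreal"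
  assumes w: "w \<in> borel_measurable M" and c: "ennreal c < (\<integral>\<^sup>+\<omega>. w \<omega> \<partial>M)"
  obtains u :: "'a \<Rightarrow> real" where "integrable M u" "\<And>\<omega>. 0 \<le> u \<omega>" "\<And>\<omega>. ennreal (u \<omega>) \<le> w \<omega>"
    "c < (LINT \<omega>|M. u \<omega>)"
proof -
  obtain K :: "nat \<Rightarrow> 'a set" where K: "range K \<subseteq> sets M" "\<Union> (range K) = space M"
    "\<And>i. emeasure M (K i) \<noteq> \<infinity>" "incseq K"
    using sigma_finite_incseq by blast
  have [measurable]: "K i \<in> sets M" for i using K(1) by auto
  note w[measurable]
  define v :: "nat \<Rightarrow> 'a \<Rightarrow> ennreal" where "v i \<omega> = min (w \<omega>) (of_nat i) * indicator (K i) \<omega>" for i \<omega>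
  have vm [measurable]: "v i \<in> borel_measurable M" for i unfolding v_def by measurable
  have v_le: "v i \<omega> \<le> w \<omega>" "v i \<omega> \<le> of_nat i * indicator (K i) \<omega>" for i \<omega>
    by (auto simp: v_def indicator_def)
  have fin: "ennreal (enn2real (v i \<omega>)) = v i \<omega>" for i \<omega>
  proof -
    have "v i \<omega> \<le> of_nat i" by (simp add: v_def indicator_def)
    also have "\<dots> < top" by (rule of_nat_less_top)
    finally show ?thesis by simp
  qed
  have int: "integrable M (\<lambda>\<omega>. enn2real (v i \<omega>))" for i
  proof (rule integrableI_nonneg)
    have "(\<integral>\<^sup>+\<omega>. ennreal (enn2real (v i \<omega>)) \<partial>M) \<le> (\<integral>\<^sup>+\<omega>. of_nat i * indicator (K i) \<omega> \<partial>M)"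
      unfolding fin by (intro nn_integral_mono v_le)
    also have "\<dots> = of_nat i * emeasure M (K i)" by (simp add: nn_integral_cmult)
    also have "\<dots> < \<infinity>" using K(3)[of i] by (simp add: ennreal_mult_less_top of_nat_less_top less_top)
    finally show "(\<integral>\<^sup>+\<omega>. ennreal (enn2real (v i \<omega>)) \<partial>M) < \<infinity>" .
  qed simp_all
  have "(\<integral>\<^sup>+\<omega>. w \<omega> \<partial>M) = (\<integral>\<^sup>+\<omega>. (SUP i. v i \<omega>) \<partial>M)"
  proof (rule nn_integral_cong)
    fix \<omega> assume "\<omega> \<in> space M"
    then obtain i0 where i0: "\<omega> \<in> K i0" using K(2) by blast
    have "w \<omega> \<le> (SUP i. v i \<omega>)"
      unfolding le_SUP_iff
    proof (intro allI impI)
      fix y assume y: "y < w \<omega>"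
      then obtain n where "y < of_nat n" using ennreal_Ex_less_of_nat[OF less_le_trans[OF y top_greatest]] by blast
      also have "of_nat n \<le> (of_nat (max i0 n) :: ennreal)" by simp
      finally have "y < of_nat (max i0 n)" .
      moreover have "\<omega> \<in> K (max i0 n)" using i0 incseqD[OF K(4), of i0 "max i0 n"] by auto
      ultimately have "y < v (max i0 n) \<omega>" using y by (simp add: v_def)
      then show "\<exists>i\<in>UNIV. y < v i \<omega>" by blast
    qed
    then show "w \<omega> = (SUP i. v i \<omega>)" by (intro antisym SUP_least v_le) auto
  qed
  also have "\<dots> = (SUP i. \<integral>\<^sup>+\<omega>. v i \<omega> \<partial>M)"
  proof (rule nn_integral_monotone_convergence_SUP)
    show "incseq v"
    proof (intro incseq_SucI le_funI)
      fix i \<omega>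
      have "min (w \<omega>) (of_nat i) \<le> min (w \<omega>) (of_nat (Suc i))" by (intro min.mono of_nat_mono) auto
      then show "v i \<omega> \<le> v (Suc i) \<omega>"
        using incseq_SucD[OF K(4), of i] unfolding v_def by (auto simp: indicator_def)
    qed
  qed simp
  finally obtain i where "ennreal c < (\<integral>\<^sup>+\<omega>. v i \<omega> \<partial>M)" using c by (auto simp: less_SUP_iff)
  also have "(\<integral>\<^sup>+\<omega>. v i \<omega> \<partial>M) = ennreal (LINT \<omega>|M. enn2real (v i \<omega>))"
    using nn_integral_eq_integral[OF int[of i]] by (simp add: fin)
  finally have "c < (LINT \<omega>|M. enn2real (v i \<omega>))" by (meson ennreal_leI not_less)
  then show ?thesis using int fin v_le(1) by (intro that[of "\<lambda>\<omega>. enn2real (v i \<omega>)"]) auto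
qed

section \<open>Difference quotients of integral functionals\<close>

lemma upper_integral_le:
  assumes "integrable M u" "AE \<omega> in M. v \<omega> \<le> ereal (u \<omega>)"
  shows "upper_integral M v \<le> ereal (LINT \<omega>|M. u \<omega>)"
  unfolding upper_integral_def using assms by (intro INF_lower) auto

lemma upper_integral_ge:
  assumes "\<And>u. integrable M u \<Longrightarrow> AE \<omega> in M. v \<omega> \<le> ereal (u \<omega>) \<Longrightarrow> c \<le> ereal (LINT \<omega>|M. u \<omega>)"
  shows "c \<le> upper_integral M v"
  unfolding upper_integral_def using assms by (intro INF_greatest) auto

lemma upper_integral_eq:
  assumes u0: "integrable M u0" and v: "AE \<omega> in M. v \<omega> = ereal (u0 \<omega>)"
  shows "upper_integral M v = ereal (LINT \<omega>|M. u0 \<omega>)"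
proof (rule antisym)
  show "upper_integral M v \<le> ereal (LINT \<omega>|M. u0 \<omega>)"
    using v by (intro upper_integral_le u0) (auto elim: eventually_mono)
  show "ereal (LINT \<omega>|M. u0 \<omega>) \<le> upper_integral M v"
  proof (rule upper_integral_ge)
    fix u assume u: "integrable M u" "AE \<omega> in M. v \<omega> \<le> ereal (u \<omega>)"
    have "AE \<omega> in M. u0 \<omega> \<le> u \<omega>" using u(2) v by eventually_elim simp
    then show "ereal (LINT \<omega>|M. u0 \<omega>) \<le> ereal (LINT \<omega>|M. u \<omega>)"
      using integral_mono_AE[OF u0 u(1)] by simp
  qed
qed

lemma weak_subdiffD:
  assumes \<phi>: "\<phi> \<in> weak_subdiff Y J y0" and y: "weakly_tendsto Y y l"
    and r: "\<And>n. r n > 0" "r \<longlonglongrightarrow> 0"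
  shows "ereal (\<phi> l) \<le> liminf (\<lambda>n. diff_quot Y J y0 (y n) (r n))"
proof -
  have "ereal (\<phi> l) \<le> weak_lower_deriv Y J y0 l"
    using \<phi> y by (auto simp: weak_subdiff_def weakly_tendsto_def)
  also have "\<dots> \<le> liminf (\<lambda>n. diff_quot Y J y0 (y n) (r n))"
    unfolding weak_lower_deriv_def using y r by (intro Inf_lower) auto
  finally show ?thesis .
qed

text \<open>
  The form in which subdifferentiability is contradicted: quotients along a weakly null sequence
  of directions cannot stay below a negative number.
\<close>

lemma weak_subdiff_L1_null_sequence:
  assumes \<phi>: "\<phi> \<in> weak_subdiff (L1_space M) J y0"
    and y: "weakly_tendsto (L1_space M) y (\<lambda>_. 0)"
    and r: "\<And>n. r n > 0" "r \<longlonglongrightarrow> 0"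
    and le: "\<And>n. diff_quot (L1_space M) J y0 (y n) (r n) \<le> ereal (- c)"
  shows "c \<le> 0"
proof -
  have "\<phi> (\<lambda>_. 0) = 0" using \<phi> dual_L1_zero by (auto simp: weak_subdiff_def)
  then have "0 \<le> liminf (\<lambda>n. diff_quot (L1_space M) J y0 (y n) (r n))"
    using weak_subdiffD[OF \<phi> y r] by (simp add: zero_ereal_def)
  also have "\<dots> \<le> liminf (\<lambda>n. ereal (- c))" by (intro Liminf_mono always_eventually allI le)
  also have "\<dots> = ereal (- c)" by (intro Liminf_const) simp
  finally show ?thesis by (simp add: zero_ereal_def)
qed

lemma neg_part_minorant:
  assumes "q < 0" "0 \<le> u" "ennreal u \<le> e2ennreal (- q)"
  shows "q \<le> ereal (- u)"
  using assms by (cases q) (auto simp: zero_ereal_def ennreal_le_iff)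

lemma max_zero_eq_enn2ereal: "max 0 x = enn2ereal (e2ennreal x)"
proof (cases "0 \<le> x")
  case True then show ?thesis by (simp add: enn2ereal_e2ennreal)
next
  case False then show ?thesis by (simp add: e2ennreal_neg zero_ennreal.rep_eq)
qed

locale integrand_at = sigma_finite_measure M for M :: "'w measure" +
  fixes f :: "'w \<Rightarrow> 'e::{banach, second_countable_topology} \<Rightarrow> ereal" and x0 :: "'w \<Rightarrow> 'e"
    and u0 :: "'w \<Rightarrow> real"
  assumes f_measurable: "(\<lambda>(\<omega>, e). f \<omega> e) \<in> borel_measurable (M \<Otimes>\<^sub>M borel)"
    and x0_integrable: "integrable M x0"
    and u0_integrable: "integrable M u0"
    and f_x0: "AE \<omega> in M. f \<omega> (x0 \<omega>) = ereal (u0 \<omega>)"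
begin

abbreviation quot :: "('w \<Rightarrow> 'e) \<Rightarrow> real \<Rightarrow> 'w \<Rightarrow> ereal" where
  "quot y r \<omega> \<equiv> diff_quot type_space (f \<omega>) (x0 \<omega>) (y \<omega>) r"

abbreviation functional_quot :: "('w \<Rightarrow> 'e) \<Rightarrow> real \<Rightarrow> ereal" where
  "functional_quot y r \<equiv> diff_quot (L1_space M) (integral_functional M f) x0 y r"

lemma f_comp_measurable:
  assumes y: "y \<in> borel_measurable M" shows "(\<lambda>\<omega>. f \<omega> (y \<omega>)) \<in> borel_measurable M"
proof -
  have "(\<lambda>\<omega>. (\<omega>, y \<omega>)) \<in> M \<rightarrow>\<^sub>M M \<Otimes>\<^sub>M borel" using y by simp
  from measurable_compose[OF this f_measurable] show ?thesis by simp
qed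

lemma quot_measurable [measurable]:
  assumes y [measurable]: "y \<in> borel_measurable M" shows "quot y r \<in> borel_measurable M"
proof -
  have [measurable]: "x0 \<in> borel_measurable M" using x0_integrable by simp
  have [measurable]: "(\<lambda>\<omega>. f \<omega> (x0 \<omega>)) \<in> borel_measurable M" by (rule f_comp_measurable) simp
  have [measurable]: "(\<lambda>\<omega>. f \<omega> (x0 \<omega> + r *\<^sub>R y \<omega>)) \<in> borel_measurable M"
    by (rule f_comp_measurable) measurable
  show ?thesis unfolding diff_quot_def type_space_def by simp
qed

lemma integral_functional_x0: "integral_functional M f x0 = ereal (LINT \<omega>|M. u0 \<omega>)"
  unfolding integral_functional_def by (rule upper_integral_eq[OF u0_integrable f_x0])

text \<open>
  Restricting the direction to \<open>B\<close> leaves \<open>f(x0)\<close> unchanged outside \<open>B\<close>, so \<open>u0 - r u\<close> is an integrable majorant.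
  Passing from direction \<open>y\<close> and step \<open>r\<close> to direction \<open>s y\<close> and step \<open>r / s\<close> does not
  change the point of evaluation and multiplies the quotient by \<open>s\<close>.
\<close>

lemma functional_quot_cut_le:
  assumes r: "r > 0" and s: "s > 0" and u: "integrable M u"
    and inside: "AE \<omega> in M. \<omega> \<in> B \<longrightarrow> quot y r \<omega> \<le> ereal (- u \<omega>)"
    and outside: "\<And>\<omega>. \<omega> \<in> space M \<Longrightarrow> \<omega> \<notin> B \<Longrightarrow> u \<omega> = 0"
  shows "functional_quot (\<lambda>\<omega>. s *\<^sub>R cut B y \<omega>) (r / s) \<le> ereal (- (s * (LINT \<omega>|M. u \<omega>)))"
proof -
  have "AE \<omega> in M. f \<omega> (x0 \<omega> + r *\<^sub>R cut B y \<omega>) \<le> ereal (u0 \<omega> - r * u \<omega>)"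
    using f_x0 inside AE_space
  proof eventually_elim
    case (elim \<omega>)
    show ?case
    proof (cases "\<omega> \<in> B")
      case False then show ?thesis using elim outside by simp
    next
      case True
      then have q: "ereal (inverse r) * (f \<omega> (x0 \<omega> + r *\<^sub>R y \<omega>) - ereal (u0 \<omega>)) \<le> ereal (- u \<omega>)"
        using elim by (simp add: diff_quot_def type_space_def)
      show ?thesis
      proof (cases "f \<omega> (x0 \<omega> + r *\<^sub>R y \<omega>)")
        case (real a)
        then have "inverse r * (a - u0 \<omega>) \<le> - u \<omega>" using q by simp
        then have "a - u0 \<omega> \<le> - (r * u \<omega>)" using r by (simp add: field_simps)
        then show ?thesis using True real by simp
      next
        case PInf then show ?thesis using q r by simp
      next
        case MInf then show ?thesis using True by simp
      qed
    qed
  qed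
  moreover have "integrable M (\<lambda>\<omega>. u0 \<omega> - r * u \<omega>)" using u u0_integrable by simp
  ultimately have "integral_functional M f (\<lambda>\<omega>. x0 \<omega> + r *\<^sub>R cut B y \<omega>) \<le> ereal (LINT \<omega>|M. u0 \<omega> - r * u \<omega>)"
    unfolding integral_functional_def by (intro upper_integral_le) auto
  also have "(LINT \<omega>|M. u0 \<omega> - r * u \<omega>) = (LINT \<omega>|M. u0 \<omega>) - r * (LINT \<omega>|M. u \<omega>)"
    using u u0_integrable by simp
  finally have "integral_functional M f (\<lambda>\<omega>. x0 \<omega> + r *\<^sub>R cut B y \<omega>) - ereal (LINT \<omega>|M. u0 \<omega>)
      \<le> ereal (- (r * (LINT \<omega>|M. u \<omega>)))"
    by (cases "integral_functional M f (\<lambda>\<omega>. x0 \<omega> + r *\<^sub>R cut B y \<omega>)") auto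
  then have "ereal (s / r) * (integral_functional M f (\<lambda>\<omega>. x0 \<omega> + r *\<^sub>R cut B y \<omega>) - ereal (LINT \<omega>|M. u0 \<omega>))
      \<le> ereal (s / r) * ereal (- (r * (LINT \<omega>|M. u \<omega>)))"
    using r s by (intro ereal_mult_left_mono) auto
  also have "\<dots> = ereal (- (s * (LINT \<omega>|M. u \<omega>)))" using r by simp
  finally show ?thesis using s by (simp add: diff_quot_def integral_functional_x0)
qed

section \<open>Subdifferentiability implies lower compactness\<close>

text \<open>
  If the integrals exceed \<open>k + 1\<close> along a subsequence whose steps are at most \<open>1 / (k + 1)\<^sup>2\<close>, multiplying the
  directions and dividing the steps by \<open>\<sigma> k = 1 / (k + 1)\<close> sends both to zero while the quotients are
  at most \<open>-1\<close>.
\<close>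

lemma negative_parts_bounded:
  assumes \<phi>: "\<phi> \<in> weak_subdiff (L1_space M) (integral_functional M f) x0"
    and r: "\<And>n. r n > 0" "r \<longlonglongrightarrow> 0"
    and S: "rel_seq_weakly_compact (L1_space M) S" "range x \<subseteq> S"
  shows "\<exists>n0 C. \<forall>n\<ge>n0. (\<integral>\<^sup>+\<omega>. e2ennreal (- quot (x n) (r n) \<omega>) \<partial>M) \<le> ennreal C"
proof (rule ccontr)
  assume neg: "\<not> ?thesis"
  have ex: "\<exists>n\<ge>k. r n \<le> inverse (real (Suc k)) ^ 2 \<and>
      ennreal (real (Suc k)) < (\<integral>\<^sup>+\<omega>. e2ennreal (- quot (x n) (r n) \<omega>) \<partial>M)" for k
  proof -
    have "\<forall>\<^sub>F n in sequentially. r n < inverse (real (Suc k)) ^ 2" using r(2) by (rule order_tendstoD) simp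
    then obtain N where N: "\<And>n. n \<ge> N \<Longrightarrow> r n < inverse (real (Suc k)) ^ 2"
      unfolding eventually_sequentially by blast
    obtain n where "n \<ge> max N k" "ennreal (real (Suc k)) < (\<integral>\<^sup>+\<omega>. e2ennreal (- quot (x n) (r n) \<omega>) \<partial>M)"
      using neg by (meson not_less)
    then show ?thesis using N[of n] by (intro exI[of _ n]) auto
  qed
  obtain g where g: "\<And>k. g k \<ge> k" "\<And>k. r (g k) \<le> inverse (real (Suc k)) ^ 2"
    "\<And>k. ennreal (real (Suc k)) < (\<integral>\<^sup>+\<omega>. e2ennreal (- quot (x (g k)) (r (g k)) \<omega>) \<partial>M)"
    using ex by metis
  have "range (x \<circ> g) \<subseteq> S" using S(2) by auto
  then obtain l s where s: "strict_mono s" and w: "weakly_tendsto (L1_space M) ((x \<circ> g) \<circ> s) l"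
    using S(1) unfolding rel_seq_weakly_compact_def by blast
  define n where "n k = g (s k)" for k
  obtain C where C: "\<And>k. L1_norm M (x (n k)) \<le> C"
    using weakly_convergent_imp_L1_bounded[OF w] by (auto simp: n_def)
  have int: "integrable M (x (n k))" for k using w by (auto simp: weakly_tendsto_def n_def)
  then have [measurable]: "x (n k) \<in> borel_measurable M" for k by auto
  have sk: "k \<le> s k" for k using s by (rule strict_mono_imp_increasing)
  define \<sigma> where "\<sigma> k = inverse (real (Suc k))" for k
  have \<sigma>: "\<sigma> k > 0" for k by (simp add: \<sigma>_def)
  have rn: "r (n k) \<le> \<sigma> k ^ 2" for k
  proof -
    have "inverse (real (Suc (s k))) \<le> \<sigma> k" unfolding \<sigma>_def using sk[of k] by (intro le_imp_inverse_le) auto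
    then have "inverse (real (Suc (s k))) ^ 2 \<le> \<sigma> k ^ 2" by (intro power_mono) auto
    then show ?thesis using g(2)[of "s k"] by (simp add: n_def)
  qed
  define B where "B k = {\<omega>\<in>space M. quot (x (n k)) (r (n k)) \<omega> < 0}" for k
  have Bm: "B k \<in> sets M" for k unfolding B_def by measurable
  have "\<exists>u. integrable M u \<and> (\<forall>\<omega>. 0 \<le> u \<omega>) \<and> (\<forall>\<omega>. ennreal (u \<omega>) \<le> e2ennreal (- quot (x (n k)) (r (n k)) \<omega>)) \<and>
      real (Suc k) < (LINT \<omega>|M. u \<omega>)" for k
  proof -
    have "ennreal (real (Suc k)) \<le> ennreal (real (Suc (s k)))" using sk[of k] by (intro ennreal_leI) simp
    also have "\<dots> < (\<integral>\<^sup>+\<omega>. e2ennreal (- quot (x (n k)) (r (n k)) \<omega>) \<partial>M)" using g(3) by (simp add: n_def)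
    finally have large: "ennreal (real (Suc k)) < (\<integral>\<^sup>+\<omega>. e2ennreal (- quot (x (n k)) (r (n k)) \<omega>) \<partial>M)" .
    have "(\<lambda>\<omega>. e2ennreal (- quot (x (n k)) (r (n k)) \<omega>)) \<in> borel_measurable M" by measurable
    then obtain v where v: "integrable M v" "\<And>\<omega>. 0 \<le> v \<omega>"
      "\<And>\<omega>. ennreal (v \<omega>) \<le> e2ennreal (- quot (x (n k)) (r (n k)) \<omega>)" "real (Suc k) < (LINT \<omega>|M. v \<omega>)"
      by (rule integrable_minorant_of_large_integral[OF _ large]) (rule that)
    show ?thesis by (rule exI[of _ v]) (intro conjI allI v)
  qed
  then obtain u where u: "\<And>k. integrable M (u k)" "\<And>k \<omega>. 0 \<le> u k \<omega>"
    "\<And>k \<omega>. ennreal (u k \<omega>) \<le> e2ennreal (- quot (x (n k)) (r (n k)) \<omega>)" "\<And>k. real (Suc k) < (LINT \<omega>|M. u k \<omega>)"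
    by metis
  define y where "y k = (\<lambda>\<omega>. \<sigma> k *\<^sub>R cut (B k) (x (n k)) \<omega>)" for k
  have "weakly_tendsto (L1_space M) y (\<lambda>_. 0)"
  proof (rule L1_tendsto_zero_imp_weakly)
    show yi: "integrable M (y k)" for k
      unfolding y_def by (intro Bochner_Integration.integrable_scaleR_right integrable_cut int Bm)
    show "(\<lambda>k. L1_norm M (y k)) \<longlonglongrightarrow> 0"
    proof (rule tendsto_sandwich[where f = "\<lambda>_. 0" and h = "\<lambda>k. \<sigma> k * C"])
      have "(\<lambda>k. \<sigma> k * C) \<longlonglongrightarrow> 0 * C" unfolding \<sigma>_def by (intro tendsto_mult LIMSEQ_inverse_real_of_nat tendsto_const)
      then show "(\<lambda>k. \<sigma> k * C) \<longlonglongrightarrow> 0" by simp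
      have "L1_norm M (y k) \<le> \<sigma> k * C" for k
      proof -
        have "L1_norm M (y k) \<le> (LINT \<omega>|M. \<sigma> k * norm (x (n k) \<omega>))"
          unfolding L1_norm_def using \<sigma>[of k]
          by (intro integral_mono integrable_norm yi integrable_mult_right int)
            (auto simp: y_def indicator_def)
        also have "\<dots> = \<sigma> k * L1_norm M (x (n k))" by (simp add: L1_norm_def)
        also have "\<dots> \<le> \<sigma> k * C" using C \<sigma>[of k] by (intro mult_left_mono) auto
        finally show ?thesis .
      qed
      then show "\<forall>\<^sub>F k in sequentially. L1_norm M (y k) \<le> \<sigma> k * C" by simp
    qed auto
  qed
  moreover have "r (n k) / \<sigma> k > 0" for k using r(1) \<sigma> by simp
  moreover have "(\<lambda>k. r (n k) / \<sigma> k) \<longlonglongrightarrow> 0"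
  proof (rule tendsto_sandwich[where f = "\<lambda>_. 0" and h = \<sigma>])
    show "\<forall>\<^sub>F k in sequentially. r (n k) / \<sigma> k \<le> \<sigma> k"
      using rn \<sigma> by (simp add: divide_le_eq power2_eq_square)
    show "\<forall>\<^sub>F k in sequentially. 0 \<le> r (n k) / \<sigma> k" using r(1) \<sigma> by (simp add: less_imp_le)
    show "\<sigma> \<longlonglongrightarrow> 0" unfolding \<sigma>_def by (rule LIMSEQ_inverse_real_of_nat)
  qed simp
  moreover have "functional_quot (y k) (r (n k) / \<sigma> k) \<le> ereal (- 1)" for k
  proof -
    have "functional_quot (y k) (r (n k) / \<sigma> k) \<le> ereal (- (\<sigma> k * (LINT \<omega>|M. u k \<omega>)))"
      unfolding y_def
    proof (rule functional_quot_cut_le[OF r(1) \<sigma> u(1)])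
      show "AE \<omega> in M. \<omega> \<in> B k \<longrightarrow> quot (x (n k)) (r (n k)) \<omega> \<le> ereal (- u k \<omega>)"
        using neg_part_minorant[OF _ u(2,3)] by (auto simp: B_def)
      fix \<omega> assume "\<omega> \<in> space M" "\<omega> \<notin> B k"
      then have "e2ennreal (- quot (x (n k)) (r (n k)) \<omega>) = 0"
        by (intro e2ennreal_neg) (auto simp: B_def not_less ereal_uminus_le_0_iff)
      then show "u k \<omega> = 0" using u(2,3)[of k \<omega>] by (simp add: ennreal_eq_0_iff)
    qed
    also have "\<dots> \<le> ereal (- 1)"
      using mult_left_mono[OF less_imp_le[OF u(4)[of k]], of "\<sigma> k"] \<sigma>[of k] by (simp add: \<sigma>_def)
    finally show ?thesis .
  qed
  ultimately have "(1 :: real) \<le> 0" by (rule weak_subdiff_L1_null_sequence[OF \<phi>])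
  then show False by simp
qed

text \<open>
  The sets \<open>B k\<close> on which the direction is kept are those parts of escaping sets where the quotient is negative; the
  directions restricted to them are weakly null.
\<close>

proposition weak_diff_lower_compact_if_subdifferentiable:
  assumes \<phi>: "\<phi> \<in> weak_subdiff (L1_space M) (integral_functional M f) x0"
  shows "weak_diff_lower_compact M f x0"
  unfolding weak_diff_lower_compact_def
proof (intro allI impI)
  fix r :: "nat \<Rightarrow> real" and x :: "nat \<Rightarrow> 'w \<Rightarrow> 'e" and S
  assume r': "\<forall>n. r n > 0" and r0: "r \<longlonglongrightarrow> 0"
    and S: "rel_seq_weakly_compact (L1_space M) S" "range x \<subseteq> S"
  have r: "r n > 0" for n using r' by simp
  obtain n0 C where C: "\<And>n. n \<ge> n0 \<Longrightarrow> (\<integral>\<^sup>+\<omega>. e2ennreal (- quot (x n) (r n) \<omega>) \<partial>M) \<le> ennreal C"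
    using negative_parts_bounded[OF \<phi> r r0 S] by blast
  have xi: "integrable M (x n)" for n
    using S by (auto simp: rel_seq_weakly_compact_def)
  then have [measurable]: "x n \<in> borel_measurable M" for n by auto
  define w where "w = (\<lambda>n \<omega>. e2ennreal (- quot (x n) (r n) \<omega>))"
  have [measurable]: "w n \<in> borel_measurable M" for n unfolding w_def by measurable
  define v where "v n \<omega> = enn2real (w n \<omega>)" for n \<omega>
  have fin: "AE \<omega> in M. w n \<omega> = ennreal (v n \<omega>)" if n: "n \<ge> n0" for n
  proof -
    have "(\<integral>\<^sup>+\<omega>. w n \<omega> \<partial>M) \<noteq> \<infinity>" using le_less_trans[OF C[OF n] ennreal_less_top] by (simp add: w_def)
    then have "AE \<omega> in M. w n \<omega> \<noteq> \<infinity>" by (intro nn_integral_PInf_AE) auto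
    then show ?thesis by eventually_elim (simp add: v_def ennreal_enn2real_if)
  qed
  have v0: "0 \<le> v n \<omega>" for n \<omega> by (simp add: v_def)
  have nn: "(\<integral>\<^sup>+\<omega>. ennreal (v n \<omega>) \<partial>M) = (\<integral>\<^sup>+\<omega>. w n \<omega> \<partial>M)" if "n \<ge> n0" for n
    using fin[OF that] by (intro nn_integral_cong_AE) (auto elim: eventually_mono)
  have vi: "integrable M (v n)" if n: "n \<ge> n0" for n
  proof (rule integrableI_nonneg)
    show "(\<integral>\<^sup>+\<omega>. ennreal (v n \<omega>) \<partial>M) < \<infinity>"
      using le_less_trans[OF C[OF n] ennreal_less_top] unfolding nn[OF n] by (simp add: w_def)
  qed (auto simp: v_def[abs_def])
  have vC: "L1_norm M (v n) \<le> max C 0" if n: "n \<ge> n0" for n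
  proof -
    have "ennreal (L1_norm M (v n)) = (\<integral>\<^sup>+\<omega>. w n \<omega> \<partial>M)"
      using nn_integral_eq_integral[OF vi[OF n]] v0 unfolding nn[OF n] by (simp add: L1_norm_def)
    then have "ennreal (L1_norm M (v n)) \<le> ennreal (max C 0)"
      using order_trans[OF C[OF n] ennreal_leI[OF max.cobounded1]] by (simp only: w_def)
    then show ?thesis by (simp add: ennreal_le_iff)
  qed
  have "uniformly_integrable M (range (\<lambda>n. v (n + n0)))"
  proof (rule uniformly_integrableI_escaping[where C = "max C 0"])
    fix g A and \<epsilon> :: real
    assume g: "filterlim g sequentially sequentially" and A: "escaping M A" and \<epsilon>: "\<epsilon> > 0"
    show "\<exists>k. L1_norm M (cut (A k) (v (g k + n0))) \<le> \<epsilon>"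
    proof (rule ccontr)
      assume "\<not> ?thesis"
      then have large: "L1_norm M (cut (A k) (v (g k + n0))) \<ge> \<epsilon>" for k by (auto simp: not_le less_imp_le)
      have "range (\<lambda>k. x (g k + n0)) \<subseteq> S" using S(2) by auto
      then obtain l s where s: "strict_mono s" and wk: "weakly_tendsto (L1_space M) ((\<lambda>k. x (g k + n0)) \<circ> s) l"
        using S(1) unfolding rel_seq_weakly_compact_def by blast
      have s': "filterlim s sequentially sequentially" using s by (rule filterlim_subseq)
      define n where "n k = g (s k) + n0" for k
      have n_lim: "filterlim n sequentially sequentially"
        using filterlim_compose[OF g s'] by (rule filterlim_at_top_mono) (simp add: n_def)
      have wk: "weakly_tendsto (L1_space M) (\<lambda>k. x (n k)) l" using wk by (simp add: n_def o_def)
      define B where "B k = A (s k) \<inter> {\<omega>\<in>space M. quot (x (n k)) (r (n k)) \<omega> < 0}" for k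
      have As: "A k \<in> sets M" for k using A by (rule escaping_sets)
      have B: "escaping M B"
        by (rule escaping_subset[OF escaping_compose[OF A s']]) (use As in \<open>auto simp: B_def\<close>)
      define u where "u k = cut (A (s k)) (v (n k))" for k
      have ui: "integrable M (u k)" for k unfolding u_def by (intro integrable_cut vi As) (simp add: n_def)
      have "functional_quot (cut (B k) (x (n k))) (r (n k)) \<le> ereal (- \<epsilon>)" for k
      proof -
        have "functional_quot (\<lambda>\<omega>. 1 *\<^sub>R cut (B k) (x (n k)) \<omega>) (r (n k) / 1) \<le> ereal (- (1 * (LINT \<omega>|M. u k \<omega>)))"
        proof (rule functional_quot_cut_le[OF r _ ui])
          have "AE \<omega> in M. w (n k) \<omega> = ennreal (v (n k) \<omega>)" by (rule fin) (simp add: n_def)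
          then show "AE \<omega> in M. \<omega> \<in> B k \<longrightarrow> quot (x (n k)) (r (n k)) \<omega> \<le> ereal (- u k \<omega>)"
          proof eventually_elim
            case (elim \<omega>)
            show ?case
            proof
              assume "\<omega> \<in> B k"
              then show "quot (x (n k)) (r (n k)) \<omega> \<le> ereal (- u k \<omega>)"
                using elim v0 by (intro neg_part_minorant) (auto simp: B_def u_def w_def)
            qed
          qed
          fix \<omega> assume \<omega>: "\<omega> \<in> space M" "\<omega> \<notin> B k"
          show "u k \<omega> = 0"
          proof (cases "\<omega> \<in> A (s k)")
            case True
            then have "w (n k) \<omega> = 0" using \<omega> unfolding w_def
              by (intro e2ennreal_neg) (auto simp: B_def not_less ereal_uminus_le_0_iff)
            then show ?thesis by (simp add: u_def v_def)
          qed (simp add: u_def)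
        qed simp
        also have "\<dots> \<le> ereal (- \<epsilon>)"
          using large[of "s k"] v0 by (simp add: u_def n_def L1_norm_def)
        finally show ?thesis by simp
      qed
      then have "\<epsilon> \<le> 0"
        by (intro weak_subdiff_L1_null_sequence[OF \<phi> weakly_tendsto_cut_escaping[OF wk B], of "\<lambda>k. r (n k)"]
            r filterlim_compose[OF r0 n_lim])
      then show False using \<epsilon> by simp
    qed
  qed (use vi vC in auto)
  moreover have "range (\<lambda>n. v (n + n0)) = v ` {n0..}"
  proof -
    have "{n0..} = range (\<lambda>n. n + n0)"
      by (auto simp: image_iff) (metis le_add_diff_inverse2)
    then show ?thesis by (simp only: image_image)
  qed
  moreover have "AE \<omega> in M. max 0 (- quot (x n) (r n) \<omega>) = ereal (v n \<omega>)" if "n \<ge> n0" for n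
    using fin[OF that]
  proof eventually_elim
    case (elim \<omega>)
    then show ?case using v0[of n \<omega>] by (simp add: max_zero_eq_enn2ereal w_def)
  qed
  ultimately have "(\<forall>n\<ge>n0. AE \<omega> in M. max 0 (- quot (x n) (r n) \<omega>) = ereal (v n \<omega>)) \<and>
      uniformly_integrable M (v ` {n0..})" by simp
  then show "\<exists>n0 u. (\<forall>n\<ge>n0. AE \<omega> in M. max 0 (- quot (x n) (r n) \<omega>) = ereal (u n \<omega>)) \<and>
      uniformly_integrable M (u ` {n0..})" by blast
qed

end

section \<open>Pointwise subgradients and their pairings\<close>

text \<open>
  Pointwise directions need not converge, but bounded ones have weakly convergent subsequences by
  reflexivity, and along these the definition of the weak subdifferential applies.
\<close>

lemma weak_subdiff_bounded_lower_bound: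
  fixes J :: "'e::{real_normed_vector, second_countable_topology} \<Rightarrow> ereal"
  assumes refl: "reflexive_space TYPE('e)"
    and \<psi>: "blinfun_apply \<psi> \<in> weak_subdiff type_space J y0"
    and r: "\<And>n. r n > 0" "r \<longlonglongrightarrow> 0" and \<epsilon>: "\<epsilon> > 0"
  shows "\<forall>\<^sub>F n in sequentially. norm (e n) \<le> R \<longrightarrow>
    ereal (blinfun_apply \<psi> (e n) - \<epsilon>) \<le> diff_quot type_space J y0 (e n) (r n)"
proof (rule ccontr)
  assume "\<not> ?thesis"
  then have "\<exists>n\<ge>N. norm (e n) \<le> R \<and>
      diff_quot type_space J y0 (e n) (r n) < ereal (blinfun_apply \<psi> (e n) - \<epsilon>)" for N
    unfolding eventually_sequentially by (meson not_le)
  then obtain g where g: "\<And>N. g N \<ge> N" "\<And>N. norm (e (g N)) \<le> R"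
    "\<And>N. diff_quot type_space J y0 (e (g N)) (r (g N)) < ereal (blinfun_apply \<psi> (e (g N)) - \<epsilon>)"
    by metis
  obtain t l where t: "strict_mono (t :: nat \<Rightarrow> nat)"
    and wk: "weakly_tendsto type_space ((\<lambda>N. e (g N)) \<circ> t) l"
    using reflexive_bounded_weakly_convergent_subseq[OF refl, of "\<lambda>N. e (g N)" R] g(2) by blast
  define n where "n k = g (t k)" for k
  have wk: "weakly_tendsto type_space (\<lambda>k. e (n k)) l" using wk by (simp add: n_def o_def)
  have "filterlim n sequentially sequentially"
    using filterlim_subseq[OF t] by (rule filterlim_at_top_mono) (simp add: n_def g(1))
  then have rn: "(\<lambda>k. r (n k)) \<longlonglongrightarrow> 0" by (rule filterlim_compose[OF r(2)])
  have "(\<lambda>k. blinfun_apply \<psi> (e (n k))) \<longlonglongrightarrow> blinfun_apply \<psi> l"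
    using wk by (simp add: weakly_tendsto_def dual_type_space blinfun.bounded_linear_right)
  then have "(\<lambda>k. ereal (blinfun_apply \<psi> (e (n k)) - \<epsilon>)) \<longlonglongrightarrow> ereal (blinfun_apply \<psi> l - \<epsilon>)"
    by (intro tendsto_ereal tendsto_diff tendsto_const)
  then have lim: "liminf (\<lambda>k. ereal (blinfun_apply \<psi> (e (n k)) - \<epsilon>)) = ereal (blinfun_apply \<psi> l - \<epsilon>)"
    by (intro lim_imp_Liminf) auto
  have "ereal (blinfun_apply \<psi> l) \<le> liminf (\<lambda>k. diff_quot type_space J y0 (e (n k)) (r (n k)))"
    by (rule weak_subdiffD[OF \<psi> wk r(1) rn])
  also have "\<dots> \<le> liminf (\<lambda>k. ereal (blinfun_apply \<psi> (e (n k)) - \<epsilon>))"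
    using g(3) by (intro Liminf_mono always_eventually allI) (simp add: n_def less_imp_le)
  finally show False unfolding lim using \<epsilon> by simp
qed

text \<open>
  Measurability is clear for evaluation at a fixed vector and extends to varying vectors
  by approximating \<open>y\<close> by simple functions.
\<close>

lemma blinfun_apply_measurable:
  fixes xs :: "'w \<Rightarrow> 'e::{banach, second_countable_topology} \<Rightarrow>\<^sub>L real"
  assumes xs [measurable]: "xs \<in> borel_measurable M" and y: "y \<in> borel_measurable M"
  shows "(\<lambda>\<omega>. blinfun_apply (xs \<omega>) (y \<omega>)) \<in> borel_measurable M"
proof -
  obtain F where F: "\<And>i. simple_function M (F i)" "\<And>\<omega>. \<omega> \<in> space M \<Longrightarrow> (\<lambda>i. F i \<omega>) \<longlonglongrightarrow> y \<omega>"
    using borel_measurable_implies_sequence_metric[OF y, of 0] by blast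
  have const: "(\<lambda>\<omega>. blinfun_apply (xs \<omega>) e) \<in> borel_measurable M" for e
    using xs by (rule borel_measurable_continuous_on[rotated])
      (intro linear_continuous_on blinfun.bounded_linear_left)
  show ?thesis
  proof (rule borel_measurable_LIMSEQ_real)
    show "(\<lambda>i. blinfun_apply (xs \<omega>) (F i \<omega>)) \<longlonglongrightarrow> blinfun_apply (xs \<omega>) (y \<omega>)" if "\<omega> \<in> space M" for \<omega>
      using F(2)[OF that] by (intro tendsto_intros)
    fix i
    have fin: "finite (F i ` space M)" using F(1) by (rule simple_functionD)
    have sm: "F i -` {e} \<inter> space M \<in> sets M" for e using F(1) by (rule simple_functionD)
    have "(\<lambda>\<omega>. \<Sum>e\<in>F i ` space M. indicator (F i -` {e} \<inter> space M) \<omega> * blinfun_apply (xs \<omega>) e) \<in> borel_measurable M"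
      using const sm by (intro borel_measurable_sum borel_measurable_times borel_measurable_indicator)
    moreover have "blinfun_apply (xs \<omega>) (F i \<omega>) =
        (\<Sum>e\<in>F i ` space M. indicator (F i -` {e} \<inter> space M) \<omega> * blinfun_apply (xs \<omega>) e)"
      if \<omega>: "\<omega> \<in> space M" for \<omega>
    proof -
      have "(\<Sum>e\<in>F i ` space M. indicator (F i -` {e} \<inter> space M) \<omega> * blinfun_apply (xs \<omega>) e) =
          (\<Sum>e\<in>F i ` space M. if e = F i \<omega> then blinfun_apply (xs \<omega>) e else 0)"
        using \<omega> by (intro sum.cong) (auto simp: indicator_def)
      also have "\<dots> = blinfun_apply (xs \<omega>) (F i \<omega>)" using \<omega> fin by (simp add: sum.delta)
      finally show ?thesis by simp
    qed
    ultimately show "(\<lambda>\<omega>. blinfun_apply (xs \<omega>) (F i \<omega>)) \<in> borel_measurable M"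
      by (simp cong: measurable_cong)
  qed
qed

lemma Linf_pairing_dual:
  fixes xs :: "'w \<Rightarrow> 'e::{banach, second_countable_topology} \<Rightarrow>\<^sub>L real"
  assumes xs: "xs \<in> borel_measurable M" and bd: "AE \<omega> in M. norm (xs \<omega>) \<le> C"
  shows Linf_pairing_integrable: "integrable M y \<Longrightarrow> integrable M (\<lambda>\<omega>. blinfun_apply (xs \<omega>) (y \<omega>))"
    and Linf_pairing_in_dual: "Linf_pairing M xs \<in> dual (L1_space M)"
proof -
  have le: "AE \<omega> in M. norm (blinfun_apply (xs \<omega>) (y \<omega>)) \<le> norm (\<bar>C\<bar> *\<^sub>R y \<omega>)" for y
    using bd
  proof eventually_elim
    case (elim \<omega>)
    have "norm (blinfun_apply (xs \<omega>) (y \<omega>)) \<le> norm (xs \<omega>) * norm (y \<omega>)" by (rule norm_blinfun)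
    also have "\<dots> \<le> \<bar>C\<bar> * norm (y \<omega>)" using elim by (intro mult_right_mono) auto
    finally show ?case by simp
  qed
  have int: "integrable M (\<lambda>\<omega>. blinfun_apply (xs \<omega>) (y \<omega>))" if y: "integrable M y" for y
  proof (rule Bochner_Integration.integrable_bound[OF _ _ le])
    show "integrable M (\<lambda>\<omega>. \<bar>C\<bar> *\<^sub>R y \<omega>)" using y by simp
    show "(\<lambda>\<omega>. blinfun_apply (xs \<omega>) (y \<omega>)) \<in> borel_measurable M"
      by (rule blinfun_apply_measurable[OF xs borel_measurable_integrable[OF y]])
  qed
  then show "integrable M y \<Longrightarrow> integrable M (\<lambda>\<omega>. blinfun_apply (xs \<omega>) (y \<omega>))" .
  have "\<bar>Linf_pairing M xs y\<bar> \<le> \<bar>C\<bar> * L1_norm M y" if y: "integrable M y" for y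
  proof -
    have "\<bar>Linf_pairing M xs y\<bar> \<le> (LINT \<omega>|M. norm (blinfun_apply (xs \<omega>) (y \<omega>)))"
      unfolding Linf_pairing_def real_norm_def[symmetric] by (rule integral_norm_bound)
    also have "\<dots> \<le> (LINT \<omega>|M. norm (\<bar>C\<bar> *\<^sub>R y \<omega>))"
      using y int le by (intro integral_mono_AE integrable_norm) auto
    also have "\<dots> = \<bar>C\<bar> * L1_norm M y" by (simp add: L1_norm_def)
    finally show ?thesis .
  qed
  then show "Linf_pairing M xs \<in> dual (L1_space M)"
    by (auto simp: dual_def Linf_pairing_def int blinfun.add_right blinfun.scaleR_right)
qed

text \<open>
  Splitting \<open>A k\<close> according to the sign of the pairing turns the norm into a difference of two
  values of the functional \<open>Linf_pairing M xs\<close> at restrictions to escaping sets.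
\<close>

lemma weakly_convergent_pairing_escaping:
  fixes xs :: "'w \<Rightarrow> 'e::{banach, second_countable_topology} \<Rightarrow>\<^sub>L real"
  assumes xs: "xs \<in> borel_measurable M" and bd: "AE \<omega> in M. norm (xs \<omega>) \<le> C"
    and y: "weakly_tendsto (L1_space M) y l" and A: "escaping M A"
  shows "(\<lambda>k. L1_norm M (cut (A k) (\<lambda>\<omega>. blinfun_apply (xs \<omega>) (y k \<omega>)))) \<longlonglongrightarrow> 0"
proof -
  have yi: "integrable M (y k)" for k using y by (auto simp: weakly_tendsto_def)
  note pi = Linf_pairing_integrable[OF xs bd]
  have [measurable]: "(\<lambda>\<omega>. blinfun_apply (xs \<omega>) (y k \<omega>)) \<in> borel_measurable M" for k
    using pi[OF yi] by auto
  have As: "A k \<in> sets M" for k using A by (rule escaping_sets)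
  define P where "P k = {\<omega>\<in>space M. blinfun_apply (xs \<omega>) (y k \<omega>) \<ge> 0}" for k
  have Ps: "P k \<in> sets M" for k unfolding P_def by measurable
  have esc: "escaping M (\<lambda>k. A k \<inter> P k)" "escaping M (\<lambda>k. A k - P k)"
    by (rule escaping_subset[OF A]; use As Ps in auto)+
  have lim: "(\<lambda>k. Linf_pairing M xs (cut (B k) (y k))) \<longlonglongrightarrow> 0" if "escaping M B" for B
  proof -
    have d: "Linf_pairing M xs \<in> dual (L1_space M)" by (rule Linf_pairing_in_dual[OF xs bd])
    then show ?thesis
      using weakly_tendsto_cut_escaping[OF y that] dual_L1_zero[OF d] by (auto simp: weakly_tendsto_def)
  qed
  have "L1_norm M (cut (A k) (\<lambda>\<omega>. blinfun_apply (xs \<omega>) (y k \<omega>))) =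
      Linf_pairing M xs (cut (A k \<inter> P k) (y k)) - Linf_pairing M xs (cut (A k - P k) (y k))" for k
  proof -
    have "L1_norm M (cut (A k) (\<lambda>\<omega>. blinfun_apply (xs \<omega>) (y k \<omega>))) =
       (LINT \<omega>|M. blinfun_apply (xs \<omega>) (cut (A k \<inter> P k) (y k) \<omega>) - blinfun_apply (xs \<omega>) (cut (A k - P k) (y k) \<omega>))"
      unfolding L1_norm_def
      by (intro Bochner_Integration.integral_cong) (auto simp: indicator_def P_def)
    also have "\<dots> = Linf_pairing M xs (cut (A k \<inter> P k) (y k)) - Linf_pairing M xs (cut (A k - P k) (y k))"
      unfolding Linf_pairing_def using As Ps
      by (intro Bochner_Integration.integral_diff pi integrable_cut yi) auto
    finally show ?thesis .
  qed
  then show ?thesis using tendsto_diff[OF lim[OF esc(1)] lim[OF esc(2)]] by simp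
qed

section \<open>Lower compactness implies the inclusion\<close>

text \<open>
  The positive part of \<open>p - q\<close>, read as zero where it is infinite, which happens only for \<open>q = -\<infinity>\<close>.
\<close>

definition deficit :: "real \<Rightarrow> ereal \<Rightarrow> real" where
  "deficit p q = enn2real (e2ennreal (ereal p - q))"

lemma deficit_nonneg [simp]: "0 \<le> deficit p q"
  by (simp add: deficit_def)

lemma deficit_ereal [simp]: "deficit p (ereal a) = max 0 (p - a)" "deficit p \<infinity> = 0"
  by (auto simp: deficit_def max_def e2ennreal_neg ennreal_neg)

lemma deficit_le: "ereal (p - \<epsilon>) \<le> q \<Longrightarrow> 0 \<le> \<epsilon> \<Longrightarrow> deficit p q \<le> \<epsilon>"
  by (cases q) auto

lemma deficit_finite:
  assumes "max 0 (- q) = ereal u"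
  shows "deficit p q \<le> \<bar>p\<bar> + \<bar>u\<bar>" "ereal (p - deficit p q) \<le> q"
  using assms by (cases q; auto simp: max_def zero_ereal_def split: if_splits)+

context integrand_at
begin

lemma deficit_measurable:
  assumes "p \<in> borel_measurable M" "y \<in> borel_measurable M"
  shows "(\<lambda>\<omega>. deficit (p \<omega>) (quot y r \<omega>)) \<in> borel_measurable M"
proof -
  note assms[measurable] quot_measurable[OF assms(2), measurable]
  show ?thesis unfolding deficit_def by measurable
qed

text \<open>
  Every integrable majorant of \<open>f\<close> at the perturbed point is also a majorant of \<open>u0 + r (p - h)\<close>.
\<close>

lemma functional_quot_ge:
  assumes r: "r > 0" and p: "integrable M p" and h: "integrable M h"
    and ge: "AE \<omega> in M. ereal (p \<omega> - h \<omega>) \<le> quot y r \<omega>"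
  shows "ereal ((LINT \<omega>|M. p \<omega>) - (LINT \<omega>|M. h \<omega>)) \<le> functional_quot y r"
proof -
  let ?I = "(LINT \<omega>|M. p \<omega>) - (LINT \<omega>|M. h \<omega>)"
  have "ereal ((LINT \<omega>|M. u0 \<omega>) + r * ?I) \<le> integral_functional M f (\<lambda>\<omega>. x0 \<omega> + r *\<^sub>R y \<omega>)"
    unfolding integral_functional_def
  proof (rule upper_integral_ge)
    fix u assume u: "integrable M u" "AE \<omega> in M. f \<omega> (x0 \<omega> + r *\<^sub>R y \<omega>) \<le> ereal (u \<omega>)"
    have "AE \<omega> in M. u0 \<omega> + r * (p \<omega> - h \<omega>) \<le> u \<omega>"
      using u(2) ge f_x0
    proof eventually_elim
      case (elim \<omega>)
      then have q: "ereal (p \<omega> - h \<omega>) \<le> ereal (inverse r) * (f \<omega> (x0 \<omega> + r *\<^sub>R y \<omega>) - ereal (u0 \<omega>))"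
        by (simp add: diff_quot_def type_space_def)
      show ?case
      proof (cases "f \<omega> (x0 \<omega> + r *\<^sub>R y \<omega>)")
        case (real a)
        then have "p \<omega> - h \<omega> \<le> inverse r * (a - u0 \<omega>)" using q by simp
        then have "r * (p \<omega> - h \<omega>) \<le> a - u0 \<omega>" using r by (simp add: field_simps)
        then show ?thesis using elim(1) real by simp
      next
        case PInf then show ?thesis using elim(1) by simp
      next
        case MInf then show ?thesis using q r by simp
      qed
    qed
    then have "(LINT \<omega>|M. u0 \<omega> + r * (p \<omega> - h \<omega>)) \<le> (LINT \<omega>|M. u \<omega>)"
      using u0_integrable p h u(1) by (intro integral_mono_AE) auto
    then show "ereal ((LINT \<omega>|M. u0 \<omega>) + r * ?I) \<le> ereal (LINT \<omega>|M. u \<omega>)"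
      using u0_integrable p h by simp
  qed
  then have "ereal (r * ?I) \<le> integral_functional M f (\<lambda>\<omega>. x0 \<omega> + r *\<^sub>R y \<omega>) - ereal (LINT \<omega>|M. u0 \<omega>)"
    by (cases "integral_functional M f (\<lambda>\<omega>. x0 \<omega> + r *\<^sub>R y \<omega>)") auto
  then have "ereal (inverse r) * ereal (r * ?I)
      \<le> ereal (inverse r) * (integral_functional M f (\<lambda>\<omega>. x0 \<omega> + r *\<^sub>R y \<omega>) - ereal (LINT \<omega>|M. u0 \<omega>))"
    using r by (intro ereal_mult_left_mono) auto
  also have "ereal (inverse r) * ereal (r * ?I) = ereal ?I" using r by simp
  finally show ?thesis by (simp add: diff_quot_def integral_functional_x0)
qed

text \<open>
  Convergence in measure with respect to a finite weight \<open>w \<le> 1\<close> follows by truncation. Where the norm of \<open>y n\<close> is at most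
  \<open>R\<close>, the deficits tend to zero pointwise; the remaining set has weighted measure at most \<open>C / R\<close> by
  Markov's inequality.
\<close>

lemma deficit_AE_null_subseq:
  assumes refl: "reflexive_space TYPE('e)"
    and xs: "xs \<in> borel_measurable M"
    and sel: "AE \<omega> in M. blinfun_apply (xs \<omega>) \<in> weak_subdiff type_space (f \<omega>) (x0 \<omega>)"
    and y: "\<And>n. integrable M (y n)" "\<And>n. L1_norm M (y n) \<le> C"
    and r: "\<And>n. r n > 0" "r \<longlonglongrightarrow> 0"
  obtains t where "strict_mono t"
    "AE \<omega> in M. (\<lambda>k. deficit (blinfun_apply (xs \<omega>) (y (t k) \<omega>)) (quot (y (t k)) (r (t k)) \<omega>)) \<longlonglongrightarrow> 0"
proof -
  obtain w :: "'w \<Rightarrow> real" where w: "w \<in> borel_measurable M" "\<And>\<omega>. w \<omega> > 0" "\<And>\<omega>. w \<omega> \<le> 1" "integrable M w"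
    by (rule obtain_positive_integrable_function) (rule that)
  note w(1)[measurable]
  define h where "h n \<omega> = deficit (blinfun_apply (xs \<omega>) (y n \<omega>)) (quot (y n) (r n) \<omega>)" for n \<omega>
  have ym [measurable]: "y n \<in> borel_measurable M" for n using y(1) by auto
  have hm [measurable]: "h n \<in> borel_measurable M" for n
    unfolding h_def[abs_def] by (rule deficit_measurable[OF blinfun_apply_measurable[OF xs ym] ym])
  have h0: "0 \<le> h n \<omega>" for n \<omega> by (simp add: h_def)
  define G where "G n \<omega> = w \<omega> * min 1 (h n \<omega>)" for n \<omega>
  have Gm [measurable]: "G n \<in> borel_measurable M" for n unfolding G_def[abs_def] by measurable
  have G0: "0 \<le> G n \<omega>" and Gw: "G n \<omega> \<le> w \<omega>" for n \<omega>
    using w(2)[of \<omega>] h0[of n \<omega>] by (auto simp: G_def mult_le_cancel_left1 less_imp_le)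
  have Gi: "integrable M (G n)" for n
    by (rule Bochner_Integration.integrable_bound[OF w(4)])
      (use G0 in \<open>auto intro!: AE_I2 order_trans[OF Gw abs_ge_self]\<close>)
  have trunc: "(\<lambda>n. LINT \<omega>|M. indicator {\<omega>\<in>space M. norm (y n \<omega>) \<le> R} \<omega> * G n \<omega>) \<longlonglongrightarrow> 0" for R
  proof -
    have "(\<lambda>n. LINT \<omega>|M. indicator {\<omega>\<in>space M. norm (y n \<omega>) \<le> R} \<omega> * G n \<omega>) \<longlonglongrightarrow> (LINT \<omega>|M. 0)"
    proof (rule integral_dominated_convergence[OF _ _ w(4)])
      show "AE \<omega> in M. (\<lambda>n. indicator {\<omega>\<in>space M. norm (y n \<omega>) \<le> R} \<omega> * G n \<omega>) \<longlonglongrightarrow> 0"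
        using sel
      proof eventually_elim
        case (elim \<omega>)
        show ?case
        proof (rule tendstoI)
          fix \<epsilon> :: real assume \<epsilon>: "\<epsilon> > 0"
          have "\<forall>\<^sub>F n in sequentially. norm (y n \<omega>) \<le> R \<longrightarrow>
              ereal (blinfun_apply (xs \<omega>) (y n \<omega>) - \<epsilon> / 2) \<le> quot (y n) (r n) \<omega>"
            by (rule weak_subdiff_bounded_lower_bound[OF refl elim r]) (use \<epsilon> in simp)
          then show "\<forall>\<^sub>F n in sequentially. dist (indicator {\<omega>\<in>space M. norm (y n \<omega>) \<le> R} \<omega> * G n \<omega>) 0 < \<epsilon>"
          proof eventually_elim
            case (elim n)
            show ?case
            proof (cases "norm (y n \<omega>) \<le> R")
              case True
              then have "h n \<omega> \<le> \<epsilon> / 2" using elim \<epsilon> unfolding h_def by (intro deficit_le) auto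
              moreover have "G n \<omega> \<le> 1 * h n \<omega>"
                unfolding G_def using w(2,3)[of \<omega>] h0 by (intro mult_mono) (auto simp: less_imp_le)
              ultimately show ?thesis using G0[of n \<omega>] \<epsilon> by (auto simp: indicator_def dist_real_def)
            qed (use \<epsilon> in simp)
          qed
        qed
      qed
      show "AE \<omega> in M. norm (indicator {\<omega>\<in>space M. norm (y n \<omega>) \<le> R} \<omega> * G n \<omega>) \<le> w \<omega>" for n
        using G0 Gw w(2) by (auto simp: indicator_def less_imp_le)
    qed measurable
    then show ?thesis by simp
  qed
  have C0: "0 \<le> C" using y(2)[of 0] L1_norm_nonneg order_trans by blast
  have "(\<lambda>n. LINT \<omega>|M. norm (G n \<omega>)) \<longlonglongrightarrow> 0"
  proof (rule tendstoI)
    fix \<epsilon> :: real assume \<epsilon>: "\<epsilon> > 0"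
    define R where "R = 2 * (C + 1) / \<epsilon>"
    have R: "R > 0" "C / R < \<epsilon> / 2" using \<epsilon> C0 by (auto simp: R_def field_simps)
    have "\<forall>\<^sub>F n in sequentially. (LINT \<omega>|M. indicator {\<omega>\<in>space M. norm (y n \<omega>) \<le> R} \<omega> * G n \<omega>) < \<epsilon> / 2"
      using trunc by (rule order_tendstoD) (use \<epsilon> in simp)
    then show "\<forall>\<^sub>F n in sequentially. dist (LINT \<omega>|M. norm (G n \<omega>)) 0 < \<epsilon>"
    proof eventually_elim
      case (elim n)
      have i: "integrable M (\<lambda>\<omega>. indicator {\<omega>\<in>space M. norm (y n \<omega>) \<le> R} \<omega> * G n \<omega>)"
      proof -
        have "{\<omega>\<in>space M. norm (y n \<omega>) \<le> R} \<in> sets M" by measurable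
        from integrable_cut[OF Gi this] show ?thesis by simp
      qed
      have "(LINT \<omega>|M. norm (G n \<omega>)) \<le>
          (LINT \<omega>|M. indicator {\<omega>\<in>space M. norm (y n \<omega>) \<le> R} \<omega> * G n \<omega> + norm (y n \<omega>) / R)"
      proof (rule integral_mono)
        show "integrable M (\<lambda>\<omega>. indicator {\<omega>\<in>space M. norm (y n \<omega>) \<le> R} \<omega> * G n \<omega> + norm (y n \<omega>) / R)"
          using i y(1) by simp
        fix \<omega> assume "\<omega> \<in> space M"
        moreover have "G n \<omega> \<le> norm (y n \<omega>) / R" if "\<not> norm (y n \<omega>) \<le> R"
        proof -
          have "G n \<omega> \<le> 1" using Gw[of n \<omega>] w(3)[of \<omega>] by linarith
          also have "1 \<le> norm (y n \<omega>) / R" using that R by (simp add: field_simps)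
          finally show ?thesis .
        qed
        ultimately show "norm (G n \<omega>) \<le> indicator {\<omega>\<in>space M. norm (y n \<omega>) \<le> R} \<omega> * G n \<omega> + norm (y n \<omega>) / R"
          using G0[of n \<omega>] R by (auto simp: indicator_def)
      qed (use Gi in auto)
      also have "\<dots> = (LINT \<omega>|M. indicator {\<omega>\<in>space M. norm (y n \<omega>) \<le> R} \<omega> * G n \<omega>) + L1_norm M (y n) / R"
        using i y(1) by (simp add: L1_norm_def)
      also have "\<dots> < \<epsilon> / 2 + \<epsilon> / 2"
        using elim divide_right_mono[OF y(2)[of n], of R] R by linarith
      finally have "(LINT \<omega>|M. norm (G n \<omega>)) < \<epsilon>" by simp
      then show ?case by (simp add: dist_real_def)
    qed
  qed
  from tendsto_L1_AE_subseq[OF Gi this] obtain t where t: "strict_mono t"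
    and ae: "AE \<omega> in M. (\<lambda>k. G (t k) \<omega>) \<longlonglongrightarrow> 0" by blast
  have "AE \<omega> in M. (\<lambda>k. h (t k) \<omega>) \<longlonglongrightarrow> 0"
    using ae
  proof eventually_elim
    case (elim \<omega>)
    have "(\<lambda>k. G (t k) \<omega> / w \<omega>) \<longlonglongrightarrow> 0 / w \<omega>" using elim w(2)[of \<omega>] by (intro tendsto_divide) auto
    moreover have "G n \<omega> / w \<omega> = min 1 (h n \<omega>)" for n using w(2)[of \<omega>] by (simp add: G_def)
    ultimately have lim: "(\<lambda>k. min 1 (h (t k) \<omega>)) \<longlonglongrightarrow> 0" by simp
    then have "\<forall>\<^sub>F k in sequentially. min 1 (h (t k) \<omega>) < 1" by (rule order_tendstoD) simp
    then have "\<forall>\<^sub>F k in sequentially. min 1 (h (t k) \<omega>) = h (t k) \<omega>"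
      by eventually_elim (simp add: min_def split: if_splits)
    then show ?case using lim by (rule Lim_transform_eventually[rotated])
  qed
  then show ?thesis using that t unfolding h_def by blast
qed

text \<open>
  Vitali's theorem. Outside the escaping sets \<open>{h k > \<delta> w}\<close> the integral of \<open>h k\<close> is at most
  \<open>\<delta>\<close> times that of \<open>w\<close>.
\<close>

lemma integral_tendsto_zero_of_escaping:
  fixes h :: "nat \<Rightarrow> 'w \<Rightarrow> real"
  assumes h: "\<And>k. integrable M (h k)" "\<And>k \<omega>. 0 \<le> h k \<omega>"
    and ae: "AE \<omega> in M. (\<lambda>k. h k \<omega>) \<longlonglongrightarrow> 0"
    and esc: "\<And>A. escaping M A \<Longrightarrow> (\<lambda>k. L1_norm M (cut (A k) (h k))) \<longlonglongrightarrow> 0"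
  shows "(\<lambda>k. LINT \<omega>|M. h k \<omega>) \<longlonglongrightarrow> 0"
proof (rule tendstoI)
  fix \<epsilon> :: real assume \<epsilon>: "\<epsilon> > 0"
  obtain w :: "'w \<Rightarrow> real" where w: "w \<in> borel_measurable M" "\<And>\<omega>. w \<omega> > 0" "\<And>\<omega>. w \<omega> \<le> 1" "integrable M w"
    by (rule obtain_positive_integrable_function) (rule that)
  note w(1)[measurable]
  have [measurable]: "h k \<in> borel_measurable M" for k using h(1) by auto
  have W0: "0 \<le> (LINT \<omega>|M. w \<omega>)" using w(2) by (intro integral_nonneg_AE) (auto simp: less_imp_le)
  \<comment> \<open>Adding \<open>1\<close> avoids a zero denominator on null spaces.\<close>
  define \<delta> where "\<delta> = \<epsilon> / (2 * ((LINT \<omega>|M. w \<omega>) + 1))"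
  have \<delta>: "\<delta> > 0" "\<delta> * (LINT \<omega>|M. w \<omega>) < \<epsilon> / 2"
    using \<epsilon> W0 by (auto simp: \<delta>_def field_simps)
  define A where "A k = {\<omega>\<in>space M. h k \<omega> > \<delta> * w \<omega>}" for k
  have As: "A k \<in> sets M" for k unfolding A_def by measurable
  have "AE \<omega> in M. \<forall>\<^sub>F k in sequentially. \<omega> \<notin> A k"
    using ae
  proof eventually_elim
    case (elim \<omega>)
    have "\<forall>\<^sub>F k in sequentially. h k \<omega> < \<delta> * w \<omega>" using elim by (rule order_tendstoD) (use \<delta> w(2) in simp)
    then show ?case by eventually_elim (simp add: A_def)
  qed
  then have "escaping M A" using As by (auto simp: escaping_def)
  from order_tendstoD(2)[OF esc[OF this], of "\<epsilon> / 2"]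
  have "\<forall>\<^sub>F k in sequentially. L1_norm M (cut (A k) (h k)) < \<epsilon> / 2" using \<epsilon> by simp
  then show "\<forall>\<^sub>F k in sequentially. dist (LINT \<omega>|M. h k \<omega>) 0 < \<epsilon>"
  proof eventually_elim
    case (elim k)
    have i: "integrable M (\<lambda>\<omega>. norm (cut (A k) (h k) \<omega>))" by (intro integrable_norm integrable_cut h As)
    have "(LINT \<omega>|M. h k \<omega>) \<le> (LINT \<omega>|M. norm (cut (A k) (h k) \<omega>) + \<delta> * w \<omega>)"
    proof (rule integral_mono[OF h(1)])
      show "integrable M (\<lambda>\<omega>. norm (cut (A k) (h k) \<omega>) + \<delta> * w \<omega>)" using i w(4) by simp
      fix \<omega> assume "\<omega> \<in> space M"
      then show "h k \<omega> \<le> norm (cut (A k) (h k) \<omega>) + \<delta> * w \<omega>"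
        using h(2)[of k \<omega>] \<delta>(1) w(2)[of \<omega>] by (auto simp: A_def indicator_def not_less)
    qed
    also have "\<dots> = L1_norm M (cut (A k) (h k)) + \<delta> * (LINT \<omega>|M. w \<omega>)"
      using i w(4) by (simp add: L1_norm_def)
    also have "\<dots> < \<epsilon>" using elim \<delta>(2) by linarith
    finally have "(LINT \<omega>|M. h k \<omega>) < \<epsilon>" .
    moreover have "0 \<le> (LINT \<omega>|M. h k \<omega>)" using h(2) by (intro integral_nonneg_AE) simp
    ultimately show ?case by (simp add: dist_real_def)
  qed
qed

text \<open>
  The subsequence \<open>n\<close> is extracted from one along which the quotients of the functional converge to
  their lower limit, so a lower bound along \<open>n\<close> is enough.
\<close>

proposition Linf_selections_subset_weak_subdiff:
  assumes refl: "reflexive_space TYPE('e)"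
    and lcp: "weak_diff_lower_compact M f x0"
    and xs: "xs \<in> Linf_selections M (\<lambda>\<omega>. weak_subdiff type_space (f \<omega>) (x0 \<omega>))"
  shows "Linf_pairing M xs \<in> weak_subdiff (L1_space M) (integral_functional M f) x0"
proof -
  obtain K where xm: "xs \<in> borel_measurable M" and xb: "AE \<omega> in M. norm (xs \<omega>) \<le> K"
    and sel: "AE \<omega> in M. blinfun_apply (xs \<omega>) \<in> weak_subdiff type_space (f \<omega>) (x0 \<omega>)"
    using xs by (auto simp: Linf_selections_def)
  have \<phi>: "Linf_pairing M xs \<in> dual (L1_space M)" by (rule Linf_pairing_in_dual[OF xm xb])
  have "ereal (Linf_pairing M xs l) \<le> liminf (\<lambda>n. functional_quot (y n) (r n))"
    if wk: "weakly_tendsto (L1_space M) y l" and r: "\<And>n. r n > 0" "r \<longlonglongrightarrow> 0" for y l r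
  proof -
    have yi: "integrable M (y n)" for n using wk by (auto simp: weakly_tendsto_def)
    obtain C where C: "\<And>n. L1_norm M (y n) \<le> C" using weakly_convergent_imp_L1_bounded[OF wk] by blast
    obtain n0 u where u: "\<And>n. n \<ge> n0 \<Longrightarrow> AE \<omega> in M. max 0 (- quot (y n) (r n) \<omega>) = ereal (u n \<omega>)"
      and ui: "uniformly_integrable M (u ` {n0..})"
    proof -
      have "\<exists>n0 u. (\<forall>n\<ge>n0. AE \<omega> in M. max 0 (- quot (y n) (r n) \<omega>) = ereal (u n \<omega>)) \<and>
          uniformly_integrable M (u ` {n0..})"
        using lcp[unfolded weak_diff_lower_compact_def, rule_format,
            OF r weakly_convergent_imp_rel_seq_weakly_compact[OF wk] subset_refl] .
      then show ?thesis using that by blast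
    qed
    define X where "X n = functional_quot (y n) (r n)" for n
    obtain s where s: "strict_mono s" "(X \<circ> s) \<longlonglongrightarrow> liminf X"
      using liminf_subseq_lim by blast
    \<comment> \<open>The shift by \<open>n0\<close> keeps all indices in the range where the negative parts are integrable.\<close>
    define m where "m k = s (k + n0)" for k
    have m: "strict_mono m" using s(1) by (simp add: m_def strict_mono_def)
    have rm: "(\<lambda>k. r (m k)) \<longlonglongrightarrow> 0" using LIMSEQ_subseq_LIMSEQ[OF r(2) m] by (simp add: o_def)
    obtain t where t: "strict_mono t" and ae: "AE \<omega> in M. (\<lambda>k. deficit (blinfun_apply (xs \<omega>) (y (m (t k)) \<omega>))
        (quot (y (m (t k))) (r (m (t k))) \<omega>)) \<longlonglongrightarrow> 0"
      using deficit_AE_null_subseq[OF refl xm sel yi C r(1) rm] by blast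
    define n where "n k = m (t k)" for k
    have n: "strict_mono n" using strict_mono_compose[OF m t] by (simp add: n_def[abs_def])
    have nn0: "n0 \<le> n k" for k
      using strict_mono_imp_increasing[OF s(1), of "t k + n0"] by (simp add: n_def m_def)
    define p where "p k \<omega> = blinfun_apply (xs \<omega>) (y (n k) \<omega>)" for k \<omega>
    have pi: "integrable M (p k)" for k
      unfolding p_def[abs_def] by (rule Linf_pairing_integrable[OF xm xb yi])
    define h where "h k \<omega> = deficit (p k \<omega>) (quot (y (n k)) (r (n k)) \<omega>)" for k \<omega>
    have uk: "u (n k) \<in> u ` {n0..}" for k using nn0 by simp
    have uint: "integrable M (u (n k))" for k using ui uk unfolding uniformly_integrable_def by blast
    have h_le: "AE \<omega> in M. norm (h k \<omega>) \<le> norm (\<bar>p k \<omega>\<bar> + \<bar>u (n k) \<omega>\<bar>)" for k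
      using u[OF nn0] by eventually_elim (use deficit_finite(1) in \<open>auto simp: h_def\<close>)
    have hm: "h k \<in> borel_measurable M" for k unfolding h_def[abs_def]
      by (rule deficit_measurable[OF borel_measurable_integrable[OF pi] borel_measurable_integrable[OF yi]])
    have hi: "integrable M (h k)" for k
      by (rule Bochner_Integration.integrable_bound[OF _ hm h_le]) (use pi uint in auto)
    have wkn: "weakly_tendsto (L1_space M) (\<lambda>k. y (n k)) l"
      using weakly_tendsto_compose[OF wk filterlim_subseq[OF n]] by (simp add: o_def)
    have h_lim: "(\<lambda>k. LINT \<omega>|M. h k \<omega>) \<longlonglongrightarrow> 0"
    proof (rule integral_tendsto_zero_of_escaping[OF hi])
      show "AE \<omega> in M. (\<lambda>k. h k \<omega>) \<longlonglongrightarrow> 0" using ae by (simp add: h_def p_def n_def)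
      fix A assume A: "escaping M A"
      have As: "A k \<in> sets M" for k using A by (rule escaping_sets)
      have le: "L1_norm M (cut (A k) (h k)) \<le> L1_norm M (cut (A k) (p k)) + L1_norm M (cut (A k) (u (n k)))" for k
      proof -
        have i: "integrable M (\<lambda>\<omega>. norm (cut (A k) v \<omega>))" if "integrable M v" for v :: "'w \<Rightarrow> real"
          by (intro integrable_norm integrable_cut that As)
        have "L1_norm M (cut (A k) (h k)) \<le> (LINT \<omega>|M. norm (cut (A k) (p k) \<omega>) + norm (cut (A k) (u (n k)) \<omega>))"
          unfolding L1_norm_def
        proof (rule integral_mono_AE)
          show "AE \<omega> in M. norm (cut (A k) (h k) \<omega>) \<le> norm (cut (A k) (p k) \<omega>) + norm (cut (A k) (u (n k)) \<omega>)"
            using h_le[of k] by eventually_elim (auto simp: indicator_def)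
        qed (intro i hi Bochner_Integration.integrable_add pi uint)+
        also have "\<dots> = L1_norm M (cut (A k) (p k)) + L1_norm M (cut (A k) (u (n k)))"
          unfolding L1_norm_def by (intro Bochner_Integration.integral_add i pi uint)
        finally show ?thesis .
      qed
      have "(\<lambda>k. L1_norm M (cut (A k) (p k)) + L1_norm M (cut (A k) (u (n k)))) \<longlonglongrightarrow> 0 + 0"
        using weakly_convergent_pairing_escaping[OF xm xb wkn A] uniformly_integrable_escapingD[OF ui uk A]
        unfolding p_def by (rule tendsto_add)
      then have lim: "(\<lambda>k. L1_norm M (cut (A k) (p k)) + L1_norm M (cut (A k) (u (n k)))) \<longlonglongrightarrow> 0"
        by simp
      show "(\<lambda>k. L1_norm M (cut (A k) (h k))) \<longlonglongrightarrow> 0"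
        by (rule tendsto_sandwich[OF _ _ tendsto_const lim]) (simp_all only: le L1_norm_nonneg eventually_True)
    qed (simp add: h_def)
    have X_ge: "ereal (Linf_pairing M xs (y (n k)) - (LINT \<omega>|M. h k \<omega>)) \<le> X (n k)" for k
      unfolding X_def Linf_pairing_def p_def[symmetric]
    proof (rule functional_quot_ge[OF r(1) pi hi])
      show "AE \<omega> in M. ereal (p k \<omega> - h k \<omega>) \<le> quot (y (n k)) (r (n k)) \<omega>"
        using u[OF nn0] by eventually_elim (use deficit_finite(2) in \<open>auto simp: h_def\<close>)
    qed
    have "(\<lambda>k. ereal (Linf_pairing M xs (y (n k)) - (LINT \<omega>|M. h k \<omega>))) \<longlonglongrightarrow> ereal (Linf_pairing M xs l - 0)"
      using wkn \<phi> by (intro tendsto_ereal tendsto_diff h_lim) (auto simp: weakly_tendsto_def)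
    moreover have "(\<lambda>k. X (n k)) \<longlonglongrightarrow> liminf X"
    proof -
      have "strict_mono (\<lambda>k. t k + n0)" using t by (simp add: strict_mono_def)
      from LIMSEQ_subseq_LIMSEQ[OF s(2) this] show ?thesis by (simp add: n_def m_def o_def)
    qed
    ultimately have "ereal (Linf_pairing M xs l - 0) \<le> liminf X"
      by (rule LIMSEQ_le) (intro exI[of _ 0] allI impI X_ge)
    then show ?thesis by (simp add: X_def[abs_def])
  qed
  then show ?thesis using \<phi>
    by (auto simp: weak_subdiff_def weak_lower_deriv_def intro!: Inf_greatest)
qed

end

theorem theorem11p2:
  fixes M :: "'w measure"
    and f :: "'w \<Rightarrow> 'e::{banach, second_countable_topology} \<Rightarrow> ereal"
    and x0 :: "'w \<Rightarrow> 'e"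
  assumes "sigma_finite_measure M"
    and "complete_measure M"
    and "reflexive_space TYPE('e)"
    and "(\<lambda>(\<omega>, e). f \<omega> e) \<in> borel_measurable (M \<Otimes>\<^sub>M borel)"
    and "integrable M x0"
    and "integrable_ereal M (\<lambda>\<omega>. f \<omega> (x0 \<omega>))"
  shows "(weak_subdiff (L1_space M) (integral_functional M f) x0 \<noteq> {} \<longrightarrow>
            weak_diff_lower_compact M f x0) \<and>
         (weak_diff_lower_compact M f x0 \<longrightarrow>
            Linf_pairing M ` Linf_selections M (\<lambda>\<omega>. weak_subdiff type_space (f \<omega>) (x0 \<omega>))
              \<subseteq> weak_subdiff (L1_space M) (integral_functional M f) x0)"
proof -
  obtain u0 where u0: "integrable M u0" "AE \<omega> in M. f \<omega> (x0 \<omega>) = ereal (u0 \<omega>)"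
    using assms(6) by (auto simp: integrable_ereal_def)
  interpret integrand_at M f x0 u0
    by (rule integrand_at.intro[OF assms(1) integrand_at_axioms.intro[OF assms(4,5) u0]])
  show ?thesis
    using weak_diff_lower_compact_if_subdifferentiable
      Linf_selections_subset_weak_subdiff[OF assms(3)] by blast
qed

end
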